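(* Let $w\in\mathfrak{S}_n$ and fix any reduced expression $w=s_1\cdots s_k$ in the adjacent transpositions. The map $\phi:\mathcal{C}^\downarrow\to[e,w]$, $\phi(C)=p(C)w$, is surjective (and hence bijective) if and only if $w$ avoids the patterns $4231$, $35142$, $42513$ and $351624$.
   Context: Permutations act on the right on $[n]=\{1,\dots,n\}$ (write $iw$), and $uw$ means "first $u$, then $w$". $\mathfrak{S}_n$ is a Coxeter group with $S$ the adjacent transpositions $(i\ i{+}1)$; its reflections $T$ are all transpositions; $\ell$ is Coxeter length. $\mathfrak{S}_n$ acts on $V=\{x\in\mathbb{R}^n:\sum x_i=0\}$ by permuting coordinates, and $(i\ j)$ is the reflection through the hyperplane $x_i=x_j$. Bruhat order: $u\le w$ iff some reduced expression of $w$ has a subword expressing $u$; $[e,w]=\{u:u\le w\}$. Put $t_i=s_1\cdots s_{i-1}s_is_{i-1}\cdots s_1$ and let $H_i\subset V$ be its reflecting hyperplane; $\mathcal{A}_w=\{H_1,\dots,H_k\}$ with $H_1>\cdots>H_k$. $L_w$ is the set of intersections of subsets of $\mathcal{A}_w$ ($\hat0=V$) ordered by reverse inclusion, covering relation $\lhd$; $\lambda(A\lhd B)=\min\{H\in\mathcal{A}_w: H\supseteq B,H\not\supseteq A\}$. $\mathcal{C}^\downarrow$ is the set of saturated chains $\hat0=X_0\lhd\cdots\lhd X_m$ (any $m\ge0$) with $\lambda(X_{i-1}\lhd X_i)>\lambda(X_i\lhd X_{i+1})$ for all $i\in[m-1]$. If $\lambda(X_{i-1}\lhd X_i)=H_{j_i}$,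 $p(C)=t_{j_1}\cdots t_{j_m}$. Pattern avoidance: for $p\in\mathfrak{S}_m$ (in one-line notation $1p\,2p\cdots mp$), $w$ avoids $p$ if there are no $1\le i_1<\cdots<i_m\le n$ with $i_aw<i_bw\iff ap<bp$ for all $a,b\in[m]$. *)

theory Defs
  imports Complex_Main "HOL-Combinatorics.Permutations" "HOL-Library.Sublist"
begin

(* Elements of the symmetric group on {1..n} are functions w :: nat => nat with
   "w permutes {1..n}".  The image of i under the right action is w i, so the product
   "first u, then w" is the function composition w o u. *)

definition perm_mult :: "(nat \<Rightarrow> nat) \<Rightarrow> (nat \<Rightarrow> nat) \<Rightarrow> (nat \<Rightarrow> nat)"  (infixl "\<odot>" 70)
  where "u \<odot> w = w \<circ> u"

definition perm_prod :: "(nat \<Rightarrow> nat) list \<Rightarrow> (nat \<Rightarrow> nat)"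
  where "perm_prod us = foldr (\<odot>) us id"

definition simple_refls :: "nat \<Rightarrow> (nat \<Rightarrow> nat) set"
  where "simple_refls n = {transpose i (i + 1) | i. 1 \<le> i \<and> i + 1 \<le> n}"

definition coxeter_length :: "nat \<Rightarrow> (nat \<Rightarrow> nat) \<Rightarrow> nat"
  where "coxeter_length n w =
    (LEAST k. \<exists>ss. set ss \<subseteq> simple_refls n \<and> perm_prod ss = w \<and> length ss = k)"

definition reduced_expression :: "nat \<Rightarrow> (nat \<Rightarrow> nat) list \<Rightarrow> (nat \<Rightarrow> nat) \<Rightarrow> bool"
  where "reduced_expression n ss w \<longleftrightarrow>
    set ss \<subseteq> simple_refls n \<and> perm_prod ss = w \<and> length ss = coxeter_length n w"

definition bruhat_le :: "nat \<Rightarrow> (nat \<Rightarrow> nat) \<Rightarrow> (nat \<Rightarrow> nat) \<Rightarrow> bool"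
  where "bruhat_le n u w \<longleftrightarrow>
    (\<exists>ss us. reduced_expression n ss w \<and> subseq us ss \<and> perm_prod us = u)"

definition bruhat_interval :: "nat \<Rightarrow> (nat \<Rightarrow> nat) \<Rightarrow> (nat \<Rightarrow> nat) set"
  where "bruhat_interval n w = {u. u permutes {1..n} \<and> bruhat_le n u w}"

(* Vectors of R^n are functions nat => real vanishing outside {1..n}. *)

definition V :: "nat \<Rightarrow> (nat \<Rightarrow> real) set"
  where "V n = {x. (\<forall>i. i \<notin> {1..n} \<longrightarrow> x i = 0) \<and> (\<Sum>i = 1..n. x i) = 0}"

(* w moves the entry in position i to position w i *)
definition perm_act :: "(nat \<Rightarrow> nat) \<Rightarrow> (nat \<Rightarrow> real) \<Rightarrow> (nat \<Rightarrow> real)"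
  where "perm_act w x = x \<circ> inv w"

(* The hyperplane of a reflection t is the set of its fixed points. *)
definition reflecting_hyperplane :: "nat \<Rightarrow> (nat \<Rightarrow> nat) \<Rightarrow> (nat \<Rightarrow> real) set"
  where "reflecting_hyperplane n t = {x \<in> V n. perm_act t x = x}"

lemma reflecting_hyperplane_transpose:
  "reflecting_hyperplane n (transpose i j) = {x \<in> V n. x i = x j}"
proof -
  have "x \<circ> transpose i j = x \<longleftrightarrow> x i = x j" for x :: "nat \<Rightarrow> real"
  proof
    assume "x \<circ> transpose i j = x"
    then have "(x \<circ> transpose i j) j = x j" by simp
    then show "x i = x j" by simp
  next
    assume "x i = x j"
    then show "x \<circ> transpose i j = x" by (auto simp: fun_eq_iff transpose_def)
  qed
  then show ?thesis
    by (simp add: reflecting_hyperplane_def perm_act_def)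
qed

(* In the definitions below ss = [s_1, ..., s_k] is a reduced expression of w.
   List positions start at 0: refl_at ss i is t_(i+1) and hyp_at n ss i is H_(i+1). *)

definition refl_at :: "(nat \<Rightarrow> nat) list \<Rightarrow> nat \<Rightarrow> (nat \<Rightarrow> nat)"
  where "refl_at ss i = perm_prod (take i ss @ [ss ! i] @ rev (take i ss))"

definition hyp_at :: "nat \<Rightarrow> (nat \<Rightarrow> nat) list \<Rightarrow> nat \<Rightarrow> (nat \<Rightarrow> real) set"
  where "hyp_at n ss i = reflecting_hyperplane n (refl_at ss i)"

definition arrangement :: "nat \<Rightarrow> (nat \<Rightarrow> nat) list \<Rightarrow> (nat \<Rightarrow> real) set set"
  where "arrangement n ss = {hyp_at n ss i | i. i < length ss}"

(* H_1 > ... > H_k: the smaller index is the larger hyperplane. *)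
definition hyp_greater ::
    "nat \<Rightarrow> (nat \<Rightarrow> nat) list \<Rightarrow> (nat \<Rightarrow> real) set \<Rightarrow> (nat \<Rightarrow> real) set \<Rightarrow> bool"
  where "hyp_greater n ss H H' \<longleftrightarrow>
    (\<exists>i j. i < j \<and> j < length ss \<and> H = hyp_at n ss i \<and> H' = hyp_at n ss j)"

definition intersection_lattice :: "nat \<Rightarrow> (nat \<Rightarrow> nat) list \<Rightarrow> (nat \<Rightarrow> real) set set"
  where "intersection_lattice n ss = {V n \<inter> \<Inter>\<B> | \<B>. \<B> \<subseteq> arrangement n ss}"

definition covers ::
    "nat \<Rightarrow> (nat \<Rightarrow> nat) list \<Rightarrow> (nat \<Rightarrow> real) set \<Rightarrow> (nat \<Rightarrow> real) set \<Rightarrow> bool"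
  where "covers n ss A B \<longleftrightarrow>
    A \<in> intersection_lattice n ss \<and> B \<in> intersection_lattice n ss \<and> B \<subset> A \<and>
    \<not> (\<exists>C \<in> intersection_lattice n ss. B \<subset> C \<and> C \<subset> A)"

definition edge_label ::
    "nat \<Rightarrow> (nat \<Rightarrow> nat) list \<Rightarrow> (nat \<Rightarrow> real) set \<Rightarrow> (nat \<Rightarrow> real) set \<Rightarrow> (nat \<Rightarrow> real) set"
  where "edge_label n ss A B =
    (let \<H> = {H \<in> arrangement n ss. B \<subseteq> H \<and> \<not> A \<subseteq> H}
     in THE H. H \<in> \<H> \<and> (\<forall>H' \<in> \<H>. H' \<noteq> H \<longrightarrow> hyp_greater n ss H' H))"

(* A chain X_0, ..., X_m is the list of its m + 1 elements. *)

definition chain_labels ::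
    "nat \<Rightarrow> (nat \<Rightarrow> nat) list \<Rightarrow> (nat \<Rightarrow> real) set list \<Rightarrow> (nat \<Rightarrow> real) set list"
  where "chain_labels n ss Xs =
    map (\<lambda>i. edge_label n ss (Xs ! i) (Xs ! (i + 1))) [0..<length Xs - 1]"

definition decreasing_chains ::
    "nat \<Rightarrow> (nat \<Rightarrow> nat) list \<Rightarrow> (nat \<Rightarrow> real) set list set"
  where "decreasing_chains n ss =
    {Xs. Xs \<noteq> [] \<and> hd Xs = V n \<and> successively (covers n ss) Xs \<and>
         successively (hyp_greater n ss) (chain_labels n ss Xs)}"

(* the reflection t_j attached to the hyperplane H_j *)
definition refl_of_hyp ::
    "nat \<Rightarrow> (nat \<Rightarrow> nat) list \<Rightarrow> (nat \<Rightarrow> real) set \<Rightarrow> (nat \<Rightarrow> nat)"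
  where "refl_of_hyp n ss H = refl_at ss (THE j. j < length ss \<and> H = hyp_at n ss j)"

definition chain_prod ::
    "nat \<Rightarrow> (nat \<Rightarrow> nat) list \<Rightarrow> (nat \<Rightarrow> real) set list \<Rightarrow> (nat \<Rightarrow> nat)"
  where "chain_prod n ss Xs = perm_prod (map (refl_of_hyp n ss) (chain_labels n ss Xs))"

definition \<phi> ::
    "nat \<Rightarrow> (nat \<Rightarrow> nat) list \<Rightarrow> (nat \<Rightarrow> nat) \<Rightarrow> (nat \<Rightarrow> real) set list \<Rightarrow> (nat \<Rightarrow> nat)"
  where "\<phi> n ss w Xs = chain_prod n ss Xs \<odot> w"

(* A pattern is given by its one-line notation, a list indexed from 0. *)
definition avoids :: "nat \<Rightarrow> (nat \<Rightarrow> nat) \<Rightarrow> nat list \<Rightarrow> bool"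
  where "avoids n w p \<longleftrightarrow>
    \<not> (\<exists>f. strict_mono_on {..<length p} f \<and> f ` {..<length p} \<subseteq> {1..n} \<and>
          (\<forall>a < length p. \<forall>b < length p. w (f a) < w (f b) \<longleftrightarrow> p ! a < p ! b))"

end

theory Submission
  imports Defs "HOL-Library.Indicator_Function"
begin

text \<open>
  The hyperplanes \<open>H\<^sub>j\<close> correspond to the inversions of \<open>w\<close>, and decreasing chains correspond to
  sets of indices \<open>j\<^sub>1 < \<dots> < j\<^sub>m\<close> without broken circuit: each \<open>j\<^sub>i\<close> is the largest index of a
  hyperplane containing \<open>H\<^bsub>j\<^sub>1\<^esub> \<inter> \<dots> \<inter> H\<^bsub>j\<^sub>i\<^esub>\<close>. The fixed space of \<open>p(C)\<close> is the last element of the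
  chain \<open>C\<close>, so \<open>p(C)\<close> determines the last label and, inductively, the whole chain.

  If \<open>w\<close> avoids the patterns, let \<open>u \<le> w\<close>. Then every point of the graph of \<open>u\<close> lies in the hull of
  the graph of \<open>w\<close>. Choose the inversion of \<open>w\<close> of largest index \<open>j\<close> inside a cycle \<open>B\<close> of \<open>u w\<^sup>-\<^sup>1\<close>; its two
  values are adjacent among the values of \<open>w\<close> on \<open>B\<close>. Pattern avoidance ensures that it exists
  and that exchanging these values in \<open>u\<close> preserves the hull condition. The exchange splits \<open>B\<close>,
  so by induction the new permutation is \<open>p(C') w\<close> for a chain \<open>C'\<close>, and appending \<open>j\<close> to \<open>C'\<close> gives a
  chain for \<open>u\<close>.

  Conversely, the inversions labelling \<open>C\<close> connect each cycle of \<open>p(C)\<close>. For every forbidden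
  pattern in \<open>w\<close> there is \<open>u \<le> w\<close> such that some cycle of \<open>u w\<^sup>-\<^sup>1\<close> is not connected by inversions of
  \<open>w\<close>, so \<open>u\<close> is not in the image.
\<close>

section \<open>Reduced words and the hull of a permutation\<close>

lemma perm_prod_Nil [simp]: "perm_prod [] = id"
  by (simp add: perm_prod_def)

lemma perm_prod_Cons [simp]: "perm_prod (u # us) = perm_prod us \<circ> u"
  by (simp add: perm_prod_def perm_mult_def)

lemma perm_prod_append [simp]: "perm_prod (us @ vs) = perm_prod vs \<circ> perm_prod us"
  by (induction us) (auto simp: o_assoc)

lemma perm_prod_permutes:
  assumes "set ss \<subseteq> simple_refls n"
  shows "perm_prod ss permutes {1..n}"
  using assms
proof (induction ss)
  case (Cons s ss)
  then obtain m where "s = transpose m (m + 1)" "1 \<le> m" "m + 1 \<le> n"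
    by (auto simp: simple_refls_def)
  then have "s permutes {1..n}"
    by (auto intro: permutes_swap_id)
  moreover have "perm_prod ss permutes {1..n}"
    using Cons by simp
  ultimately show ?case
    unfolding perm_prod_Cons by (rule permutes_compose)
qed (simp add: permutes_id[unfolded id_def] id_def)

lemma inv_comp_transpose_comp:
  assumes "bij p"
  shows "inv p \<circ> transpose a b \<circ> p = transpose (inv p a) (inv p b)"
proof
  fix x
  show "(inv p \<circ> transpose a b \<circ> p) x = transpose (inv p a) (inv p b) x"
    using assms by (auto simp: transpose_def bij_is_inj bij_inv_eq_iff)
qed

lemma perm_prod_rev_simple:
  assumes "set ss \<subseteq> simple_refls n"
  shows "perm_prod (rev ss) = inv (perm_prod ss)"
  using assms
proof (induction ss)
  case (Cons s ss)
  then obtain m where s: "s = transpose m (m + 1)"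
    by (auto simp: simple_refls_def)
  have "bij (perm_prod ss)"
    using Cons.prems by (intro permutes_bij[OF perm_prod_permutes[of _ n]]) auto
  then have "inv (perm_prod ss \<circ> s) = inv s \<circ> inv (perm_prod ss)"
    using s by (intro o_inv_distrib) auto
  moreover have "perm_prod (rev ss) = inv (perm_prod ss)" "inv s = s"
    using Cons s by simp_all
  moreover have "perm_prod (rev (s # ss)) = s \<circ> perm_prod (rev ss)"
    by (simp only: rev.simps perm_prod_append perm_prod_Cons perm_prod_Nil id_comp)
  ultimately show ?case
    by (simp only: perm_prod_Cons)
qed simp

section \<open>Reflections attached to the letters of a word, and the exchange property\<close>

lemma refl_at_append:
  "i < length ss \<Longrightarrow> refl_at (ss @ ts) i = refl_at ss i"
  by (simp add: refl_at_def nth_append)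

lemma refl_at_take:
  "i < j \<Longrightarrow> i < length ss \<Longrightarrow> refl_at (take j ss) i = refl_at ss i"
  by (simp add: refl_at_def min_def)

lemma refl_at_eq_transpose:
  assumes ss: "set ss \<subseteq> simple_refls n" and i: "i < length ss"
    and m: "ss ! i = transpose m (m + 1)"
  shows "refl_at ss i =
    transpose (inv (perm_prod (take i ss)) m) (inv (perm_prod (take i ss)) (m + 1))"
proof -
  let ?p = "perm_prod (take i ss)"
  have sub: "set (take i ss) \<subseteq> simple_refls n"
    using ss set_take_subset by fastforce
  have "bij ?p"
    using permutes_bij[OF perm_prod_permutes[OF sub]] .
  then show ?thesis
    using perm_prod_rev_simple[OF sub] inv_comp_transpose_comp[of ?p m "m + 1"] m
    by (simp add: refl_at_def o_assoc)
qed

lemma simple_reflE: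
  assumes "set ss \<subseteq> simple_refls n" "i < length ss"
  obtains m where "ss ! i = transpose m (m + 1)" "1 \<le> m" "m + 1 \<le> n"
proof -
  have "ss ! i \<in> simple_refls n"
    using assms nth_mem by blast
  then show ?thesis
    using that by (auto simp: simple_refls_def)
qed

text \<open>The reflection is the letter conjugated by the prefix, so applying it first puts a
  second copy of the letter next to the original one, and the two cancel.\<close>

lemma perm_prod_delete:
  assumes ss: "set ss \<subseteq> simple_refls n" and i: "i < length ss"
  shows "perm_prod (take i ss @ drop (Suc i) ss) = perm_prod ss \<circ> refl_at ss i"
proof -
  let ?p = "perm_prod (take i ss)"
  have sub: "set (take i ss) \<subseteq> simple_refls n"
    using ss set_take_subset by fastforce
  have bij: "bij ?p"
    using permutes_bij[OF perm_prod_permutes[OF sub]] .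
  obtain m where m: "ss ! i = transpose m (m + 1)"
    using simple_reflE[OF ss i] .
  have "perm_prod ss = perm_prod (take i ss @ ss ! i # drop (Suc i) ss)"
    using i by (simp add: Cons_nth_drop_Suc del: perm_prod_append perm_prod_Cons)
  moreover have "refl_at ss i = inv ?p \<circ> ss ! i \<circ> ?p"
    using perm_prod_rev_simple[OF sub] by (simp add: refl_at_def o_assoc)
  moreover have "?p (inv ?p x) = x" for x
    using bij by (simp add: bij_is_surj surj_f_inv_f)
  ultimately show ?thesis
    by (auto simp: fun_eq_iff m)
qed

text \<open>If the prefix without the last letter already inverts \<open>a\<close> and
  \<open>b\<close>, induct. Otherwise the last letter swaps their values, so these are
  \<open>m\<close> and \<open>m + 1\<close> and its reflection is
  \<open>transpose a b\<close>.\<close>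

lemma strong_exchange:
  assumes "set ss \<subseteq> simple_refls n" "a < b" "perm_prod ss b < perm_prod ss a"
  shows "\<exists>i < length ss. refl_at ss i = transpose a b"
  using assms
proof (induction ss rule: rev_induct)
  case (snoc s ss)
  let ?v = "perm_prod ss"
  have ss: "set ss \<subseteq> simple_refls n"
    using snoc.prems by simp
  have bij: "bij ?v"
    using permutes_bij[OF perm_prod_permutes[OF ss]] .
  show ?case
  proof (cases "?v b < ?v a")
    case True
    then show ?thesis
      using snoc ss by (metis length_append_singleton less_Suc_eq refl_at_append)
  next
    case False
    moreover have "?v a \<noteq> ?v b"
      using bij \<open>a < b\<close> by (metis bij_is_inj injD nless_le)
    ultimately have less: "?v a < ?v b" by simp
    obtain m where m: "s = transpose m (m + 1)"
      using snoc.prems by (auto simp: simple_refls_def)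
    have "?v a = m" "?v b = m + 1"
      using less snoc.prems(3) m by (auto simp: transpose_def split: if_splits)
    then have "inv ?v m = a" "inv ?v (m + 1) = b"
      using bij by (auto simp: bij_is_inj inv_f_eq)
    then have "refl_at (ss @ [s]) (length ss) = transpose a b"
      using refl_at_eq_transpose[OF snoc.prems(1), of "length ss" m] m by simp
    then show ?thesis by auto
  qed
qed simp

text \<open>Deleting two letters that carry the same reflection does not change the product.\<close>

lemma reduced_refl_at_inj:
  assumes red: "reduced_expression n ss w" and ij: "i < j" "j < length ss"
  shows "refl_at ss i \<noteq> refl_at ss j"
proof
  assume eq: "refl_at ss i = refl_at ss j"
  have ss: "set ss \<subseteq> simple_refls n" and w: "perm_prod ss = w"
    and len: "length ss = coxeter_length n w"
    using red by (auto simp: reduced_expression_def)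
  define ts where "ts = take j ss @ drop (Suc j) ss"
  define us where "us = take i ts @ drop (Suc i) ts"
  have ts: "set ts \<subseteq> simple_refls n"
    using ss set_take_subset set_drop_subset unfolding ts_def by fastforce
  have us: "set us \<subseteq> simple_refls n"
    using ts set_take_subset set_drop_subset unfolding us_def by fastforce
  obtain m where m: "ss ! j = transpose m (m + 1)"
    using simple_reflE[OF ss ij(2)] .
  have t: "refl_at ss j \<circ> refl_at ss j = id"
    using refl_at_eq_transpose[OF ss ij(2) m] by simp
  have "refl_at ts i = refl_at ss i"
    using ij refl_at_append[of i "take j ss" "drop (Suc j) ss"] refl_at_take[of i j ss]
    by (simp add: ts_def)
  moreover have "i < length ts"
    using ij by (simp add: ts_def)
  ultimately have "perm_prod us = perm_prod ts \<circ> refl_at ss i"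
    using perm_prod_delete[OF ts, of i] by (simp add: us_def)
  also have "perm_prod ts = w \<circ> refl_at ss j"
    using perm_prod_delete[OF ss ij(2)] w by (simp add: ts_def)
  finally have "perm_prod us = w"
    using t eq by (metis comp_assoc comp_id)
  then have "coxeter_length n w \<le> length us"
    unfolding coxeter_length_def using us by (intro Least_le) auto
  moreover have "length us < length ss"
    using ij by (simp add: us_def ts_def)
  ultimately show False
    using len by simp
qed

lemma take_subset_simple:
  "set ss \<subseteq> simple_refls n \<Longrightarrow> set (take i ss) \<subseteq> simple_refls n"
  using set_take_subset by fastforce

text \<open>At a descent strong exchange would yield an earlier letter with the same
  reflection.\<close>

lemma reduced_ascent:
  assumes red: "reduced_expression n ss w" and i: "i < length ss"
    and m: "ss ! i = transpose m (m + 1)"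
  shows "inv (perm_prod (take i ss)) m < inv (perm_prod (take i ss)) (m + 1)"
proof (rule ccontr)
  let ?p = "perm_prod (take i ss)"
  assume neg: "\<not> inv ?p m < inv ?p (m + 1)"
  have ss: "set ss \<subseteq> simple_refls n"
    using red by (auto simp: reduced_expression_def)
  note sub = take_subset_simple[OF ss, of i]
  have bij: "bij ?p"
    using permutes_bij[OF perm_prod_permutes[OF sub]] .
  then have pinv: "?p (inv ?p x) = x" for x
    by (simp add: bij_is_surj surj_f_inv_f)
  then have "inv ?p m \<noteq> inv ?p (m + 1)"
    by (metis add_eq_self_zero one_neq_zero)
  with neg have "inv ?p (m + 1) < inv ?p m"
    by simp
  then obtain j where "j < i" "refl_at (take i ss) j = transpose (inv ?p (m + 1)) (inv ?p m)"
    using strong_exchange[OF sub, of "inv ?p (m + 1)" "inv ?p m"] pinv i by auto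
  then have "refl_at ss j = refl_at ss i"
    using refl_at_eq_transpose[OF ss i m] refl_at_take[of j i ss] i
    by (simp add: transpose_commute)
  then show False
    using reduced_refl_at_inj[OF red \<open>j < i\<close> i] by simp
qed

lemma perm_prod_take_Suc:
  "i < length ss \<Longrightarrow> perm_prod (take (Suc i) ss) = ss ! i \<circ> perm_prod (take i ss)"
  by (simp add: take_Suc_conv_app_nth)

text \<open>A letter can undo an inversion only by swapping adjacent values at a descent of the
  prefix, which \<open>reduced_ascent\<close> rules out.\<close>

lemma reduced_inversion_mono:
  assumes red: "reduced_expression n ss w" and ab: "a < b"
    and inv: "perm_prod (take i ss) b < perm_prod (take i ss) a"
    and ij: "i \<le> j" "j \<le> length ss"
  shows "perm_prod (take j ss) b < perm_prod (take j ss) a"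
  using ij
proof (induction j rule: dec_induct)
  case base
  show ?case using inv .
next
  case (step j)
  have ss: "set ss \<subseteq> simple_refls n"
    using red by (auto simp: reduced_expression_def)
  let ?p = "perm_prod (take j ss)"
  have bij: "bij ?p"
    using permutes_bij[OF perm_prod_permutes[OF take_subset_simple[OF ss]]] .
  have j: "j < length ss" using step by simp
  obtain m where m: "ss ! j = transpose m (m + 1)"
    using simple_reflE[OF ss j] .
  have less: "?p b < ?p a"
    using step by simp
  show ?case
  proof (rule ccontr)
    assume "\<not> ?thesis"
    then have "?p b = m" "?p a = m + 1"
      using less m j by (auto simp: perm_prod_take_Suc transpose_def split: if_splits)
    then have "inv ?p m = b" "inv ?p (m + 1) = a"
      using bij by (auto simp: bij_is_inj inv_f_eq)
    then show False
      using reduced_ascent[OF red j m] ab by simp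
  qed
qed

text \<open>By the last conclusion \<open>a\<close> and \<open>b\<close> have adjacent values in the prefix of length \<open>i + 1\<close>.\<close>

lemma reduced_refl_atE:
  assumes red: "reduced_expression n ss w" and i: "i < length ss"
  obtains a b where "1 \<le> a" "a < b" "b \<le> n" "refl_at ss i = transpose a b" "w b < w a"
    "perm_prod (take (Suc i) ss) a = Suc (perm_prod (take (Suc i) ss) b)"
proof -
  have ss: "set ss \<subseteq> simple_refls n" and w: "perm_prod ss = w"
    using red by (auto simp: reduced_expression_def)
  let ?p = "perm_prod (take i ss)"
  have perm: "?p permutes {1..n}"
    using perm_prod_permutes[OF take_subset_simple[OF ss]] .
  obtain m where m: "ss ! i = transpose m (m + 1)" "1 \<le> m" "m + 1 \<le> n"
    using simple_reflE[OF ss i] .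
  define a b where "a = inv ?p m" and "b = inv ?p (m + 1)"
  have ab: "a < b"
    using reduced_ascent[OF red i m(1)] by (simp add: a_def b_def)
  have "a \<in> {1..n}" "b \<in> {1..n}"
    unfolding a_def b_def using permutes_in_image[OF permutes_inv[OF perm]] m by simp_all
  moreover have "?p a = m" "?p b = m + 1"
    unfolding a_def b_def using permutes_inverses(1)[OF perm] by simp_all
  then have suc: "perm_prod (take (Suc i) ss) a = m + 1" "perm_prod (take (Suc i) ss) b = m"
    using m i by (simp_all add: perm_prod_take_Suc)
  then have "w b < w a"
    using reduced_inversion_mono[OF red ab, of "Suc i" "length ss"] i w by simp
  ultimately show ?thesis
    using that[of a b] ab suc refl_at_eq_transpose[OF ss i m(1)] by (simp add: a_def b_def)
qed

text \<open>The graph of \<open>u\<close> lies in the right hull, in the sense of Sjostrand, of the graph of \<open>w\<close>.\<close>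

definition in_hull :: "(nat \<Rightarrow> nat) \<Rightarrow> (nat \<Rightarrow> nat) \<Rightarrow> bool"
  where "in_hull w u \<longleftrightarrow> (\<forall>i. (\<exists>i' \<le> i. u i \<le> w i') \<and> (\<exists>i' \<ge> i. w i' \<le> u i))"

text \<open>Passing to \<open>?s \<circ> v\<close> raises the value at the earlier position
  \<open>a\<close> and lowers it at the later \<open>b\<close>, which only relaxes the hull
  condition; the slack is enough to let \<open>u\<close> change by \<open>?s\<close> as
  well.\<close>

lemma in_hull_ascent:
  assumes bij: "bij v" and asc: "inv v m < inv v (m + 1)" and u: "in_hull v u"
  shows "in_hull (transpose m (m + 1) \<circ> v) u"
    and "in_hull (transpose m (m + 1) \<circ> v) (transpose m (m + 1) \<circ> u)"
proof -
  let ?s = "transpose m (m + 1)"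
  define a b where "a = inv v m" and "b = inv v (m + 1)"
  have v: "v a = m" "v b = m + 1" "a < b"
    using bij asc by (simp_all add: a_def b_def bij_is_surj surj_f_inv_f)
  have uniq: "v x = m \<longleftrightarrow> x = a" "v x = m + 1 \<longleftrightarrow> x = b" for x
    using v inj_eq[OF bij_is_inj[OF bij], of x] by metis+
  have w: "(?s \<circ> v) x = (if x = a then m + 1 else if x = b then m else v x)" for x
    using v uniq[of x] by (auto simp: transpose_def)
  \<comment> \<open>A witness survives unless it is \<open>b\<close>, whose value drops; then
    \<open>a\<close> replaces it, further left and high enough. \<open>down\<close> is the mirror
    image.\<close>
  have up: "\<exists>i' \<le> i. y \<le> (?s \<circ> v) i'" if "\<exists>i' \<le> i. y \<le> v i'" for i y
  proof -
    from that obtain i' where "i' \<le> i" "y \<le> v i'" by auto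
    show ?thesis
    proof (cases "i' = b")
      case True
      then have "a \<le> i" "y \<le> (?s \<circ> v) a"
        using v \<open>i' \<le> i\<close> \<open>y \<le> v i'\<close> unfolding w by simp_all
      then show ?thesis by blast
    next
      case False
      then have "y \<le> (?s \<circ> v) i'"
        using v \<open>y \<le> v i'\<close> unfolding w by auto
      then show ?thesis using \<open>i' \<le> i\<close> by blast
    qed
  qed
  have down: "\<exists>i' \<ge> i. (?s \<circ> v) i' \<le> y" if "\<exists>i' \<ge> i. v i' \<le> y" for i y
  proof -
    from that obtain i' where "i \<le> i'" "v i' \<le> y" by auto
    show ?thesis
    proof (cases "i' = a")
      case True
      then have "i \<le> b" "(?s \<circ> v) b \<le> y"
        using v \<open>i \<le> i'\<close> \<open>v i' \<le> y\<close> unfolding w by simp_all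
      then show ?thesis by blast
    next
      case False
      then have "(?s \<circ> v) i' \<le> y"
        using v \<open>v i' \<le> y\<close> unfolding w by auto
      then show ?thesis using \<open>i \<le> i'\<close> by blast
    qed
  qed
  \<comment> \<open>Here the bound itself rises to \<open>m + 1\<close>: the only witness of value
    exactly \<open>m\<close> is \<open>a\<close>, and its new value is \<open>m + 1\<close>.\<close>
  have up': "\<exists>i' \<le> i. m + 1 \<le> (?s \<circ> v) i'" if "\<exists>i' \<le> i. m \<le> v i'" for i
  proof -
    from that obtain i' where i': "i' \<le> i" "m \<le> v i'" by auto
    show ?thesis
    proof (cases "v i' = m")
      case True
      then have "a \<le> i" "m + 1 \<le> (?s \<circ> v) a"
        using i' uniq(1) unfolding w by simp_all
      then show ?thesis by blast
    next
      case False
      then have "m + 1 \<le> v i'" using i' by simp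
      then show ?thesis using up[of i "m + 1"] i'(1) by blast
    qed
  qed
  have down': "\<exists>i' \<ge> i. (?s \<circ> v) i' \<le> m" if "\<exists>i' \<ge> i. v i' \<le> m + 1" for i
  proof -
    from that obtain i' where i': "i \<le> i'" "v i' \<le> m + 1" by auto
    show ?thesis
    proof (cases "v i' = m + 1")
      case True
      then have "i \<le> b" "(?s \<circ> v) b \<le> m"
        using i' uniq(2) v(3) unfolding w by simp_all
      then show ?thesis by blast
    next
      case False
      then have "v i' \<le> m" using i' by simp
      then show ?thesis using down[of i m] i'(1) by blast
    qed
  qed
  have hu: "\<exists>i' \<le> i. u i \<le> v i'" and hd: "\<exists>i' \<ge> i. v i' \<le> u i" for i
    using u by (auto simp: in_hull_def)
  show "in_hull (?s \<circ> v) u"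
    unfolding in_hull_def using up[OF hu] down[OF hd] by blast
  show "in_hull (?s \<circ> v) (?s \<circ> u)"
    unfolding in_hull_def
  proof (intro allI)
    fix i
    consider "u i = m" | "u i = m + 1" | "?s (u i) = u i"
      by (metis transpose_apply_other)
    then show "(\<exists>i' \<le> i. (?s \<circ> u) i \<le> (?s \<circ> v) i') \<and> (\<exists>i' \<ge> i. (?s \<circ> v) i' \<le> (?s \<circ> u) i)"
    proof cases
      case 1
      have "\<exists>i' \<ge> i. v i' \<le> m + 1"
        using hd[of i] 1 le_SucI by auto
      then show ?thesis
        using up'[of i] down[of i "m + 1"] hu[of i] 1 by simp
    next
      case 2
      have "\<exists>i' \<le> i. m \<le> v i'"
        using hu[of i] 2 Suc_leD by auto
      then show ?thesis
        using down'[of i] up[of i m] hd[of i] 2 by simp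
    next
      case 3
      then show ?thesis
        using up[OF hu, of i] down[OF hd, of i] by simp
    qed
  qed
qed

lemma subseq_snocE:
  assumes "subseq us (xs @ [x])"
  obtains "subseq us xs" | us' where "us = us' @ [x]" "subseq us' xs"
proof -
  from assms obtain us1 us2 where us: "us = us1 @ us2" "subseq us1 xs" "subseq us2 [x]"
    by (auto simp: subseq_append_iff)
  then have "us2 = [] \<or> us2 = [x]"
    by (cases us2) (auto split: if_splits)
  then show ?thesis
    using us that by auto
qed

text \<open>Build \<open>w\<close> letter by letter. A subword skips or uses the new letter, and
  these cases are the two conclusions of \<open>in_hull_ascent\<close>.\<close>

lemma bruhat_le_in_hull:
  assumes "bruhat_le n u w"
  shows "in_hull w u"
proof -
  obtain ss us where red: "reduced_expression n ss w"
    and sub: "subseq us ss" and u: "perm_prod us = u"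
    using assms by (auto simp: bruhat_le_def)
  have ss: "set ss \<subseteq> simple_refls n" and w: "perm_prod ss = w"
    using red by (auto simp: reduced_expression_def)
  have "in_hull (perm_prod (take i ss)) (perm_prod vs)"
    if "i \<le> length ss" "subseq vs (take i ss)" for i vs
    using that
  proof (induction i arbitrary: vs)
    case 0
    then have "vs = []" by (cases vs) auto
    then show ?case by (auto simp: in_hull_def)
  next
    case (Suc i)
    let ?p = "perm_prod (take i ss)"
    have i: "i < length ss" using Suc.prems by simp
    obtain m where m: "ss ! i = transpose m (m + 1)"
      using simple_reflE[OF ss i] .
    have bij: "bij ?p"
      using permutes_bij[OF perm_prod_permutes[OF take_subset_simple[OF ss]]] .
    have eq: "perm_prod (take (Suc i) ss) = transpose m (m + 1) \<circ> ?p"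
      by (simp only: perm_prod_take_Suc[OF i] m)
    note IH = Suc.IH[OF less_imp_le[OF i]]
    note hull = in_hull_ascent[OF bij reduced_ascent[OF red i m] IH]
    have "subseq vs (take i ss @ [ss ! i])"
      using Suc.prems i by (simp add: take_Suc_conv_app_nth)
    then show ?case
    proof (cases rule: subseq_snocE)
      case 1
      then show ?thesis
        unfolding eq by (rule hull(1))
    next
      case (2 vs')
      then have "perm_prod vs = transpose m (m + 1) \<circ> perm_prod vs'"
        by (simp only: perm_prod_append perm_prod_Cons perm_prod_Nil id_comp m)
      then show ?thesis
        using hull(2)[OF 2(2)] by (simp only: eq)
    qed
  qed
  from this[of "length ss" us] show ?thesis
    using sub u w by simp
qed

text \<open>By strong exchange, undoing an inversion deletes one letter. Elements below
  \<open>w\<close> are constructed this way later on.\<close>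

lemma subword_swap:
  assumes us: "set us \<subseteq> simple_refls n" and ab: "a < b" "perm_prod us b < perm_prod us a"
  shows "\<exists>vs. subseq vs us \<and> perm_prod vs = perm_prod us \<circ> transpose a b"
proof -
  obtain i where i: "i < length us" "refl_at us i = transpose a b"
    using strong_exchange[OF us ab] by auto
  have "subseq (take i us @ drop (Suc i) us) (take i us @ us ! i # drop (Suc i) us)"
    by (simp add: subseq_append' list_emb_Cons)
  then have "subseq (take i us @ drop (Suc i) us) us"
    using i by (simp add: Cons_nth_drop_Suc)
  then show ?thesis
    using perm_prod_delete[OF us i(1)] i(2) by auto
qed

section \<open>Pattern avoidance\<close>

text \<open>Arbitrary linear orders are allowed so that the argument can be repeated on negated
  positions and values.\<close>

definition pattern_at ::
    "'a::linorder set \<Rightarrow> ('a \<Rightarrow> 'b::linorder) \<Rightarrow> nat list \<Rightarrow> 'a list \<Rightarrow> bool"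
  where "pattern_at D w p xs \<longleftrightarrow> length xs = length p \<and> sorted_wrt (<) xs \<and> set xs \<subseteq> D \<and>
    (\<forall>a < length p. \<forall>b < length p. w (xs ! a) < w (xs ! b) \<longleftrightarrow> p ! a < p ! b)"

lemma avoids_iff_no_pattern_at:
  "avoids n w p \<longleftrightarrow> (\<nexists>xs. pattern_at {1..n} w p xs)"
proof -
  have "(\<exists>f. strict_mono_on {..<length p} f \<and> f ` {..<length p} \<subseteq> {1..n} \<and>
          (\<forall>a < length p. \<forall>b < length p. w (f a) < w (f b) \<longleftrightarrow> p ! a < p ! b)) \<longleftrightarrow>
        (\<exists>xs. pattern_at {1..n} w p xs)" (is "?L \<longleftrightarrow> ?R")
  proof
    assume ?L
    then obtain f where "strict_mono_on {..<length p} f" "f ` {..<length p} \<subseteq> {1..n}"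
      "\<forall>a < length p. \<forall>b < length p. w (f a) < w (f b) \<longleftrightarrow> p ! a < p ! b" by blast
    then have "pattern_at {1..n} w p (map f [0..<length p])"
      by (auto simp: pattern_at_def sorted_wrt_iff_nth_less strict_mono_on_def)
    then show ?R by blast
  next
    assume ?R
    then obtain xs where "pattern_at {1..n} w p xs" ..
    then show ?L
      by (intro exI[of _ "(!) xs"])
        (auto simp: pattern_at_def sorted_wrt_iff_nth_less strict_mono_on_def subset_iff)
  qed
  then show ?thesis
    by (simp add: avoids_def)
qed

locale avoiding =
  fixes D :: "'a::linorder set" and w :: "'a \<Rightarrow> 'b::linorder"
  assumes inj: "inj_on w D"
    and no4231: "\<And>xs. \<not> pattern_at D w [4,2,3,1] xs"
    and no35142: "\<And>xs. \<not> pattern_at D w [3,5,1,4,2] xs"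
    and no42513: "\<And>xs. \<not> pattern_at D w [4,2,5,1,3] xs"
    and no351624: "\<And>xs. \<not> pattern_at D w [3,5,1,6,2,4] xs"
begin

lemma avoid_4231:
  assumes "set [i, j, k, l] \<subseteq> D" "i < j" "j < k" "k < l"
    and "w l < w j" "w j < w k" "w k < w i"
  shows False
  using no4231[of "[i, j, k, l]"] assms
  by (auto simp: pattern_at_def All_less_Suc numeral_eq_Suc)

lemma avoid_35142:
  assumes "set [i, j, k, l, m] \<subseteq> D" "i < j" "j < k" "k < l" "l < m"
    and "w k < w m" "w m < w i" "w i < w l" "w l < w j"
  shows False
  using no35142[of "[i, j, k, l, m]"] assms
  by (auto simp: pattern_at_def All_less_Suc numeral_eq_Suc)

lemma avoid_42513:
  assumes "set [i, j, k, l, m] \<subseteq> D" "i < j" "j < k" "k < l" "l < m"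
    and "w l < w j" "w j < w m" "w m < w i" "w i < w k"
  shows False
  using no42513[of "[i, j, k, l, m]"] assms
  by (auto simp: pattern_at_def All_less_Suc numeral_eq_Suc)

lemma avoid_351624:
  assumes "set [i, j, k, l, m, h] \<subseteq> D" "i < j" "j < k" "k < l" "l < m" "m < h"
    and "w k < w m" "w m < w i" "w i < w h" "w h < w j" "w j < w l"
  shows False
  using no351624[of "[i, j, k, l, m, h]"] assms
  by (auto simp: pattern_at_def All_less_Suc numeral_eq_Suc)

text \<open>Only one of the two bounds needed for a swap is proved; the other one is this lemma with
  both orders reversed, which exchanges 35142 and 42513 and preserves the two other patterns.\<close>

lemma swap_upper_bound:
  assumes B: "B \<subseteq> D" "finite B" "u ` B = w ` B" "inj_on u B"
    and hull1: "\<And>i. i \<in> D \<Longrightarrow> \<exists>i' \<in> D. i' \<le> i \<and> u i \<le> w i'"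
    and hull2: "\<And>i. i \<in> D \<Longrightarrow> \<exists>i' \<in> D. i \<le> i' \<and> w i' \<le> u i"
    and ab: "a \<in> B" "b \<in> B" "a < b" "w b < w a"
    and adj: "\<And>x. x \<in> B \<Longrightarrow> w x \<le> w b \<or> w a \<le> w x"
    and cd: "c \<in> B" "u c = w b"
  shows "\<exists>i \<in> D. i \<le> c \<and> w a \<le> w i"
proof (rule ccontr)
  assume neg: "\<not> ?thesis"
  \<comment> \<open>If the bound fails, \<open>c\<close> lies in \<open>B'\<close>. All of
    \<open>B'\<close> turns out to lie left of \<open>a\<close> and below the height
    \<open>w b\<close>.\<close>
  define B' where "B' = {x \<in> B. \<forall>y \<in> D. y \<le> x \<longrightarrow> w y < w a}"
  have inD: "a \<in> D" "b \<in> D" "c \<in> D"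
    using B ab cd by auto
  have c: "c \<in> B'"
    using neg cd by (auto simp: B'_def not_le)
  have B'_less: "w x < w b" "x < a" if "x \<in> B'" for x
  proof -
    show "x < a"
    proof (rule ccontr)
      assume "\<not> x < a"
      then have "w a < w a"
        using that inD unfolding B'_def by (simp only: mem_Collect_eq not_less)
      then show False by simp
    qed
    have "w x < w a" "x \<in> B"
      using that B by (auto simp: B'_def)
    then have "w x \<le> w b"
      using adj[of x] by auto
    moreover have "x \<noteq> b"
      using \<open>x < a\<close> ab by auto
    ultimately show "w x < w b"
      using inj_onD[OF inj, of x b] \<open>x \<in> B\<close> B(1) inD(2) by (auto simp: less_le)
  qed
  \<comment> \<open>Otherwise, by counting, \<open>u\<close> and \<open>w\<close> have the same
    image on \<open>B'\<close>; it contains \<open>u c = w b\<close>, although \<open>w\<close>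
    stays below \<open>w b\<close> there.\<close>
  have "\<exists>e \<in> B - B'. u e \<in> w ` B'"
  proof (rule ccontr)
    assume no: "\<not> ?thesis"
    have "w ` B' \<subseteq> u ` B'"
    proof
      fix y assume y: "y \<in> w ` B'"
      then have "y \<in> u ` B"
        using B by (auto simp: B'_def)
      then show "y \<in> u ` B'"
        using no y by auto
    qed
    moreover have fin: "finite B'" "B' \<subseteq> B"
      using B by (auto simp: B'_def)
    moreover have "card (w ` B') = card (u ` B')"
      using fin B inj by (metis card_image inj_on_subset)
    ultimately have "w ` B' = u ` B'"
      by (simp add: card_subset_eq)
    then have "w b \<in> w ` B'"
      using c cd by (metis imageI)
    then obtain x where "x \<in> B'" "w b = w x"
      by (rule imageE)
    then show False
      using B'_less(1)[of x] by simp
  qed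
  then obtain e g where e: "e \<in> B" "e \<notin> B'" and g: "g \<in> B'" "u e = w g"
    by auto
  \<comment> \<open>\<open>a0\<close> is the leftmost of \<open>a\<close> and a point that excludes
    \<open>e\<close> from \<open>B'\<close>.\<close>
  obtain a0 where a0: "a0 \<in> D" "a0 \<le> e" "a0 \<le> a" "w a \<le> w a0"
  proof -
    obtain y where y: "y \<in> D" "y \<le> e" "w a \<le> w y"
      using e by (auto simp: B'_def not_less)
    show ?thesis
    proof (cases "y \<le> a")
      case True
      then show ?thesis using y that by blast
    next
      case False
      then show ?thesis using that[of a] y inD by auto
    qed
  qed
  have less_a0: "x < a0" if "x \<in> B'" for x
  proof (rule ccontr)
    assume "\<not> x < a0"
    then have "w a0 < w a"
      using that a0(1) unfolding B'_def by (simp only: mem_Collect_eq not_less)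
    then show False
      using a0(4) by simp
  qed
  \<comment> \<open>\<open>i\<close> and, below, \<open>f\<close> are hull witnesses for
    \<open>c\<close> and \<open>e\<close>; they complete the pattern.\<close>
  obtain i where i: "i \<in> D" "i \<le> c" "w b \<le> w i"
    using hull1[OF inD(3)] cd by auto
  have wi: "w i < w a"
    using i neg by (auto simp: not_le)
  have "i \<noteq> b" "i \<noteq> c"
    using i B'_less[OF c] ab by auto
  then have i': "i < c" "w b < w i"
    using i inj_onD[OF inj, of b i] inD by (auto simp: order.strict_iff_order)
  have gD: "g \<in> D" "g \<in> B"
    using g B by (auto simp: B'_def)
  obtain f where f: "f \<in> D" "e \<le> f" "w f \<le> w g"
    using hull2[of e] e(1) B(1) g(2) by auto
  have gf: "g < f"
    using less_a0[OF g(1)] a0(2) f(2) by simp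
  have wf: "w f < w g"
    using f gD(1) gf inj_onD[OF inj, of f g] by (auto simp: order.strict_iff_order)
  have wg: "w g < w b"
    using B'_less[OF g(1)] by simp
  have "f \<noteq> a0" "f \<noteq> b"
    using wf wg a0 ab by auto
  then have f': "a0 < f"
    using a0(2) f(2) by simp
  have ca: "c < a0" "g < a0"
    using less_a0 c g by auto
  have cf: "w c \<noteq> w f"
    using inj_onD[OF inj, of c f] inD(3) f(1) ca(1) f' by auto
  have gi: "g \<noteq> i"
    using wg i' by auto
  have wc: "w c < w b"
    using B'_less[OF c] by simp
  have cb: "a0 < b" "c < b" "g < b" "w i < w a0"
    using ca a0(3,4) ab(3) wi by auto
  note facts = inD gD(1) f(1) i(1) a0(1)
  note ords = i' wi ca f' wf wg wc cb
  \<comment> \<open>\<open>c\<close>, \<open>g\<close> and \<open>i\<close> lie left of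
    \<open>a0\<close>, while \<open>b\<close> and \<open>f\<close> lie right of it. The order of
    \<open>b\<close> and \<open>f\<close>, of \<open>i\<close> and \<open>g\<close>, and, if
    \<open>g < i\<close>, of the heights of \<open>c\<close> and \<open>f\<close> decides which
    pattern appears.\<close>
  consider "b < f" "i < g" | "b < f" "g < i" "w f < w c" | "b < f" "g < i" "w c < w f"
    | "f < b" "i < g" | "f < b" "g < i" "w f < w c" | "f < b" "g < i" "w c < w f"
    using cf gi \<open>f \<noteq> b\<close> unfolding neq_iff by blast
  then show False
  proof cases
    case 1
    then show ?thesis using avoid_4231[of i g b f] facts ords by auto
  next
    case 2
    then show ?thesis using avoid_4231[of i c b f] facts ords by auto
  next
    case 3
    then show ?thesis using avoid_35142[of g i c b f] facts ords by auto
  next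
    case 4
    then show ?thesis using avoid_42513[of i g a0 f b] facts ords by auto
  next
    case 5
    then show ?thesis using avoid_42513[of i c a0 f b] facts ords by auto
  next
    case 6
    then show ?thesis using avoid_351624[of g i c a0 f b] facts ords by auto
  qed
qed

text \<open>If \<open>w\<close> increases on \<open>B\<close>, let \<open>x\<close> be the leftmost
  point of \<open>B\<close> where \<open>u\<close> and \<open>w\<close> differ. Then
  \<open>e\<close> with \<open>u e = w x\<close> and \<open>y\<close> with \<open>w y = u x\<close>
  lie right of \<open>x\<close>, and hull witnesses left of \<open>x\<close> and right of
  \<open>e\<close> complete a 4231.\<close>

lemma block_has_inversion:
  assumes B: "B \<subseteq> D" "finite B" "u ` B = w ` B" "inj_on u B" "x \<in> B" "u x \<noteq> w x"
    and hull1: "\<And>i. i \<in> D \<Longrightarrow> \<exists>i' \<in> D. i' \<le> i \<and> u i \<le> w i'"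
    and hull2: "\<And>i. i \<in> D \<Longrightarrow> \<exists>i' \<in> D. i \<le> i' \<and> w i' \<le> u i"
  shows "\<exists>a \<in> B. \<exists>b \<in> B. a < b \<and> w b < w a"
proof (rule ccontr)
  assume "\<not> ?thesis"
  then have mono: "w a < w b" if "a \<in> B" "b \<in> B" "a < b" for a b
    using that inj B(1) by (metis inj_onD linorder_neqE order_less_irrefl subsetD)
  define M where "M = {x \<in> B. u x \<noteq> w x}"
  have M: "finite M" "M \<noteq> {}"
    using B by (auto simp: M_def)
  define x where "x = Min M"
  have x: "x \<in> B" "u x \<noteq> w x"
    using Min_in[OF M] by (auto simp: x_def M_def)
  have min: "u y = w y" if "y \<in> B" "y < x" for y
    using that M Min_le[of M y] by (force simp: x_def M_def)
  obtain e where e: "e \<in> B" "u e = w x"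
    using B(3) x by (metis imageE imageI)
  obtain y where y: "y \<in> B" "w y = u x"
    using B(3) x by (metis imageE imageI)
  have injB: "inj_on w B"
    using inj B(1) by (rule inj_on_subset)
  have "x < e"
  proof (rule ccontr)
    assume "\<not> x < e"
    moreover have "e \<noteq> x" using e x by auto
    ultimately have "e < x" by auto
    then show False
      using min e x injB by (metis inj_onD order_less_irrefl)
  qed
  have "x < y"
  proof (rule ccontr)
    assume "\<not> x < y"
    moreover have "y \<noteq> x" using y x by auto
    ultimately have "y < x" by auto
    then show False
      using min[of y] y x B(4) by (metis inj_onD order_less_irrefl)
  qed
  have wxy: "w x < w y" and wxe: "w x < w e"
    using mono[of x y] mono[of x e] x y e \<open>x < y\<close> \<open>x < e\<close> by auto
  obtain i where i: "i \<in> D" "i \<le> x" "w y \<le> w i"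
    using hull1[of x] x y B(1) by auto
  obtain f where f: "f \<in> D" "e \<le> f" "w f \<le> w x"
    using hull2[of e] e B(1) by auto
  have D: "x \<in> D" "y \<in> D" "e \<in> D"
    using x y e B(1) by auto
  have "f \<noteq> e" "f \<noteq> x" "i \<noteq> x" "i \<noteq> y"
    using f wxe \<open>x < e\<close> i wxy \<open>x < y\<close> by auto
  then have f': "e < f" "w f < w x" and i': "i < x" "w y < w i"
    using f i D inj_onD[OF inj, of f x] inj_onD[OF inj, of y i]
    by (auto simp: order.strict_iff_order)
  show False
  \<comment> \<open>The middle pair of the 4231 is \<open>x\<close>, \<open>y\<close> if
    \<open>f\<close> lies beyond \<open>y\<close>; otherwise \<open>e < y\<close>, and
    \<open>x\<close>, \<open>e\<close> serve.\<close>
  proof (cases "y < f")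
    case True
    then show ?thesis
      using avoid_4231[of i x y f] D i f i' f' wxy \<open>x < y\<close> by auto
  next
    case False
    then have "e < y"
      using f' by auto
    then have "w e < w i"
      using mono[of e y] e y i'(2) by auto
    then show ?thesis
      using avoid_4231[of i x e f] D i f i' f' wxe \<open>x < e\<close> by auto
  qed
qed

end

section \<open>Decreasing chains and broken circuits\<close>

text \<open>The orthogonal projection of the restriction of \<open>f\<close> to \<open>{1..n}\<close> onto \<open>V n\<close>.\<close>

definition center :: "nat \<Rightarrow> (nat \<Rightarrow> real) \<Rightarrow> nat \<Rightarrow> real"
  where "center n f i = (if i \<in> {1..n} then f i - (\<Sum>j = 1..n. f j) / n else 0)"

lemma center_in_V: "center n f \<in> V n"
proof -
  have "(\<Sum>i = 1..n. center n f i) = (\<Sum>i = 1..n. f i - (\<Sum>j = 1..n. f j) / n)"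
    by (intro sum.cong) (auto simp: center_def)
  also have "\<dots> = 0"
    by (simp add: sum_subtractf)
  finally show ?thesis
    by (auto simp: V_def center_def)
qed

lemma center_eq_iff:
  "a \<in> {1..n} \<Longrightarrow> b \<in> {1..n} \<Longrightarrow> center n f a = center n f b \<longleftrightarrow> f a = f b"
  by (simp add: center_def)

lemma center_comp:
  assumes p: "p permutes {1..n}" and f: "\<And>i. i \<in> {1..n} \<Longrightarrow> f (p i) = f i"
  shows "center n f \<circ> p = center n f"
proof
  fix i
  show "(center n f \<circ> p) i = center n f i"
  proof (cases "i \<in> {1..n}")
    case True
    then have "p i \<in> {1..n}"
      using permutes_in_image[OF p] by simp
    then show ?thesis
      using f[OF True] True by (simp add: center_def del: atLeastAtMost_iff)
  next
    case False
    then have "p i = i"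
      using p by (rule permutes_not_in[rotated])
    then show ?thesis by simp
  qed
qed

text \<open>Pairing with a vector that is fixed by \<open>p\<close> but not by the transposition shows that the
  two factors fix a common vector separately.\<close>

lemma fixed_by_transpose_comp:
  fixes x y :: "nat \<Rightarrow> real"
  assumes p: "p permutes {1..n}" and ab: "a \<in> {1..n}" "b \<in> {1..n}"
    and x: "x \<circ> p = x" "x a \<noteq> x b" and y: "y \<circ> (transpose a b \<circ> p) = y"
  shows "y a = y b" and "y \<circ> p = y"
proof -
  let ?t = "transpose a b"
  have tp: "y (?t (p i)) = y i" for i
    using fun_cong[OF y, of i] by simp
  have xp: "x (p i) = x i" for i
    using fun_cong[OF x(1), of i] by simp
  show "y a = y b"
  proof (cases "a = b")
    case False
    \<comment> \<open>Reindexing by \<open>p\<close> shows that \<open>x\<close> has the same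
      pairing with \<open>y \<circ> ?t\<close> as with \<open>y\<close>. The difference lives on
      \<open>a\<close> and \<open>b\<close> only, and it factors.\<close>
    have "(\<Sum>i = 1..n. x i * y (?t i)) = (\<Sum>i = 1..n. x (p i) * y (?t (p i)))"
      using sum.permute[OF p, of "\<lambda>i. x i * y (?t i)"] by (simp add: o_def)
    also have "\<dots> = (\<Sum>i = 1..n. x i * y i)"
      by (simp add: tp xp)
    finally have "(\<Sum>i = 1..n. x i * (y (?t i) - y i)) = 0"
      by (simp add: right_diff_distrib sum_subtractf)
    moreover have "(\<Sum>i = 1..n. x i * (y (?t i) - y i)) =
        (\<Sum>i \<in> {a, b}. x i * (y (?t i) - y i))"
      using ab by (intro sum.mono_neutral_right) auto
    ultimately have "(x a - x b) * (y b - y a) = 0"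
      using False by (simp add: algebra_simps)
    then show ?thesis
      using x(2) by simp
  qed simp
  then have "y (?t i) = y i" for i
    by (auto simp: transpose_def)
  then show "y \<circ> p = y"
    using tp by (auto simp: fun_eq_iff)
qed

lemma chain_labels_snoc:
  assumes "Xs \<noteq> []"
  shows "chain_labels n ss (Xs @ [Y]) = chain_labels n ss Xs @ [edge_label n ss (last Xs) Y]"
proof -
  have "[0..<length Xs] = [0..<length Xs - 1] @ [length Xs - 1]"
    using assms by (cases "length Xs") auto
  then show ?thesis
    using assms by (auto simp: chain_labels_def nth_append last_conv_nth)
qed

lemma decreasing_chains_snoc:
  assumes "Xs \<noteq> []"
  shows "Xs @ [Y] \<in> decreasing_chains n ss \<longleftrightarrow>
    Xs \<in> decreasing_chains n ss \<and> covers n ss (last Xs) Y \<and>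
    (chain_labels n ss Xs \<noteq> [] \<longrightarrow>
      hyp_greater n ss (last (chain_labels n ss Xs)) (edge_label n ss (last Xs) Y))"
  using assms by (auto simp: decreasing_chains_def chain_labels_snoc successively_append_iff)

section \<open>Hyperplanes and flats attached to a reduced word\<close>

locale reduced_word =
  fixes n :: nat and w :: "nat \<Rightarrow> nat" and ss :: "(nat \<Rightarrow> nat) list"
  assumes perm: "w permutes {1..n}" and red: "reduced_expression n ss w"
begin

abbreviation "H \<equiv> hyp_at n ss"
abbreviation "r \<equiv> refl_at ss"

definition lo :: "nat \<Rightarrow> nat" where "lo j = (LEAST x. r j x \<noteq> x)"
definition hi :: "nat \<Rightarrow> nat" where "hi j = r j (lo j)"

lemma ss_simple: "set ss \<subseteq> simple_refls n" and perm_prod_ss: "perm_prod ss = w"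
  using red by (auto simp: reduced_expression_def)

lemma refl_at_transpose:
  assumes "j < length ss"
  shows "r j = transpose (lo j) (hi j)" "1 \<le> lo j" "lo j < hi j" "hi j \<le> n" "w (hi j) < w (lo j)"
    "perm_prod (take (Suc j) ss) (lo j) = Suc (perm_prod (take (Suc j) ss) (hi j))"
proof -
  obtain a b where ab: "1 \<le> a" "a < b" "b \<le> n" "r j = transpose a b" "w b < w a"
    "perm_prod (take (Suc j) ss) a = Suc (perm_prod (take (Suc j) ss) b)"
    using reduced_refl_atE[OF red assms] .
  have "lo j = a"
    unfolding lo_def using ab by (intro Least_equality) (auto simp: transpose_def split: if_splits)
  moreover from this have "hi j = b"
    using ab by (simp add: hi_def)
  ultimately show "r j = transpose (lo j) (hi j)" "1 \<le> lo j" "lo j < hi j" "hi j \<le> n"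
    "w (hi j) < w (lo j)"
    "perm_prod (take (Suc j) ss) (lo j) = Suc (perm_prod (take (Suc j) ss) (hi j))"
    using ab by simp_all
qed

lemma ends_in_range:
  assumes "j < length ss"
  shows "lo j \<in> {1..n}" "hi j \<in> {1..n}"
  using refl_at_transpose[OF assms] by auto

lemma H_eq: "j < length ss \<Longrightarrow> H j = {x \<in> V n. x (lo j) = x (hi j)}"
  using refl_at_transpose(1)[of j] by (simp add: hyp_at_def reflecting_hyperplane_transpose)

lemma r_permutes: "j < length ss \<Longrightarrow> r j permutes {1..n}"
  using refl_at_transpose(1)[of j] ends_in_range[of j] by (simp add: permutes_swap_id)

lemma r_comp_r: "j < length ss \<Longrightarrow> r j \<circ> r j = id"
  using refl_at_transpose(1)[of j] by simp

lemma in_H_iff: "j < length ss \<Longrightarrow> x \<in> H j \<longleftrightarrow> x \<in> V n \<and> x \<circ> r j = x"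
  using refl_at_transpose(1)[of j]
  by (simp add: hyp_at_def reflecting_hyperplane_def perm_act_def)

lemma r_inj: "inj_on r {..<length ss}"
  unfolding inj_on_def
  by (metis lessThan_iff linorder_neqE_nat red reduced_refl_at_inj)

text \<open>Testing on centred indicators of single points shows that a hyperplane remembers the two
  ends of its transposition.\<close>

lemma H_inj: "inj_on H {..<length ss}"
proof
  fix i j
  assume "i \<in> {..<length ss}" "j \<in> {..<length ss}" and eq: "H i = H j"
  then have ij: "i < length ss" "j < length ss" by auto
  note i = refl_at_transpose[OF ij(1)] and j = refl_at_transpose[OF ij(2)]
  have sub: "f (lo i) = f (hi i) \<longleftrightarrow> f (lo j) = f (hi j)" for f :: "nat \<Rightarrow> real"
    using eq H_eq ij center_in_V[of n f]
      center_eq_iff[OF ends_in_range[OF ij(1)], of f] center_eq_iff[OF ends_in_range[OF ij(2)], of f]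
    by (metis (mono_tags, lifting) mem_Collect_eq)
  have "lo i \<in> {lo j, hi j}" "hi i \<in> {lo j, hi j}"
    using sub[of "\<lambda>x. if x = lo i then 1 else 0"] sub[of "\<lambda>x. if x = hi i then 1 else 0"] i(3)
    by (auto split: if_splits)
  then have "r i = r j"
    using i(1,3) j(1,3) by auto
  then show "i = j"
    using r_inj ij by (auto dest: inj_onD)
qed

lemma H_eq_iff: "i < length ss \<Longrightarrow> j < length ss \<Longrightarrow> H i = H j \<longleftrightarrow> i = j"
  using H_inj by (auto dest: inj_onD)

definition flat :: "nat list \<Rightarrow> (nat \<Rightarrow> real) set"
  where "flat js = V n \<inter> (\<Inter>j \<in> set js. H j)"

definition refl_prod :: "nat list \<Rightarrow> nat \<Rightarrow> nat"
  where "refl_prod js = perm_prod (map r js)"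

lemma flat_Nil [simp]: "flat [] = V n"
  by (simp add: flat_def)

lemma flat_snoc [simp]: "flat (js @ [j]) = flat js \<inter> H j"
  by (auto simp: flat_def)

lemma flat_subset_V: "flat js \<subseteq> V n"
  by (auto simp: flat_def)

lemma flat_subset_H: "j \<in> set js \<Longrightarrow> flat js \<subseteq> H j"
  by (auto simp: flat_def)

lemma refl_prod_Nil [simp]: "refl_prod [] = id"
  by (simp add: refl_prod_def)

lemma refl_prod_snoc [simp]: "refl_prod (js @ [j]) = r j \<circ> refl_prod js"
  by (simp add: refl_prod_def)

lemma refl_prod_permutes:
  "set js \<subseteq> {..<length ss} \<Longrightarrow> refl_prod js permutes {1..n}"
proof (induction js rule: rev_induct)
  case (snoc j js)
  then show ?case
    unfolding refl_prod_snoc by (intro permutes_compose r_permutes) auto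
qed (simp add: permutes_id)

text \<open>Lists of indices whose set contains no broken circuit, where a broken circuit is a circuit
  of the arrangement without its hyperplane of largest index.\<close>

inductive nbc :: "nat list \<Rightarrow> bool"
  where
    nbc_Nil: "nbc []"
  | nbc_snoc: "nbc js \<Longrightarrow> j < length ss \<Longrightarrow> (\<And>i. i \<in> set js \<Longrightarrow> i < j) \<Longrightarrow>
      \<not> flat js \<subseteq> H j \<Longrightarrow> (\<And>i. i < length ss \<Longrightarrow> flat (js @ [j]) \<subseteq> H i \<Longrightarrow> i \<le> j) \<Longrightarrow>
      nbc (js @ [j])"

lemma nbc_subset: "nbc js \<Longrightarrow> set js \<subseteq> {..<length ss}"
  by (induction rule: nbc.induct) auto

lemma nbc_sorted: "nbc js \<Longrightarrow> sorted_wrt (<) js"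
  by (induction rule: nbc.induct) (auto simp: sorted_wrt_append)

lemma not_V_subset_H:
  assumes "j < length ss"
  shows "\<not> V n \<subseteq> H j"
proof
  assume "V n \<subseteq> H j"
  then have "center n (\<lambda>x. if x = lo j then 1 else 0) \<in> H j"
    using center_in_V by auto
  then show False
    using center_eq_iff[OF ends_in_range[OF assms]] H_eq[OF assms] refl_at_transpose(3)[OF assms]
    by (auto split: if_splits)
qed

text \<open>As \<open>flat js\<close> is not inside \<open>H j\<close>, some vector is fixed by the
  product so far but not by \<open>r j\<close>. By \<open>fixed_by_transpose_comp\<close> the
  enlarged product then fixes only the common fixed vectors.\<close>

lemma flat_nbc:
  "nbc js \<Longrightarrow> flat js = {x \<in> V n. x \<circ> refl_prod js = x}"
proof (induction rule: nbc.induct)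
  case (nbc_snoc js j)
  let ?p = "refl_prod js"
  note j = nbc_snoc.hyps(2)
  note IH = nbc_snoc.IH
  have p: "?p permutes {1..n}"
    by (rule refl_prod_permutes[OF nbc_subset[OF nbc_snoc.hyps(1)]])
  obtain x where "x \<in> flat js" "x \<notin> H j"
    using nbc_snoc.hyps(4) by auto
  then have x: "x \<circ> ?p = x" "x (lo j) \<noteq> x (hi j)"
    unfolding IH H_eq[OF j] by auto
  note rj = refl_at_transpose(1)[OF j]
  have "y \<in> flat (js @ [j]) \<longleftrightarrow> y \<in> V n \<and> y \<circ> refl_prod (js @ [j]) = y" for y
  proof
    assume "y \<in> flat (js @ [j])"
    then have "y \<in> V n" "y \<circ> ?p = y" "y \<circ> r j = y"
      unfolding flat_snoc IH in_H_iff[OF j] Int_iff by auto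
    moreover have "y \<circ> refl_prod (js @ [j]) = (y \<circ> r j) \<circ> ?p"
      by (simp only: refl_prod_snoc comp_assoc)
    ultimately show "y \<in> V n \<and> y \<circ> refl_prod (js @ [j]) = y"
      by (simp only: simp_thms)
  next
    assume y: "y \<in> V n \<and> y \<circ> refl_prod (js @ [j]) = y"
    then have "y \<circ> (transpose (lo j) (hi j) \<circ> ?p) = y"
      unfolding refl_prod_snoc rj by simp
    from fixed_by_transpose_comp[OF p ends_in_range[OF j] x this] y
    show "y \<in> flat (js @ [j])"
      unfolding flat_snoc IH H_eq[OF j] by simp
  qed
  then show ?case
    by (simp only: set_eq_iff mem_Collect_eq simp_thms)
qed simp

lemma refl_prod_snoc_cancel:
  assumes "j < length ss" "refl_prod (js @ [j]) = refl_prod (ks @ [j])"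
  shows "refl_prod js = refl_prod ks"
  using assms r_comp_r[OF assms(1)] by (metis comp_assoc id_comp refl_prod_snoc)

lemma nbc_refl_prod_inj:
  "nbc js \<Longrightarrow> nbc ks \<Longrightarrow> refl_prod js = refl_prod ks \<Longrightarrow> js = ks"
proof (induction arbitrary: ks rule: nbc.induct)
  case nbc_Nil
  have "refl_prod ks = id"
    using nbc_Nil(2) by (metis refl_prod_Nil)
  then have "flat ks = V n"
    using flat_nbc[OF nbc_Nil(1)] by simp
  with nbc_Nil(1) show ?case
    using not_V_subset_H by (cases rule: nbc.cases) auto
next
  case (nbc_snoc js j)
  note hyps = nbc_snoc.hyps and IH = nbc_snoc.IH and prod_eq = nbc_snoc.prems(2)
  have eq: "flat (js @ [j]) = flat ks"
    using flat_nbc[OF nbc_snoc.prems(1)] flat_nbc[OF nbc.nbc_snoc[OF hyps]] prod_eq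
    by (simp only:)
  from nbc_snoc.prems(1) show ?case
  proof (cases rule: nbc.cases)
    case nbc_Nil
    then show ?thesis
      using eq not_V_subset_H[OF hyps(2)] by auto
  next
    case (nbc_snoc ks' k)
    \<comment> \<open>Equal products have equal fixed spaces, and the last index is the largest one
      whose hyperplane contains that space.\<close>
    have "flat (js @ [j]) \<subseteq> H k" "flat (ks' @ [k]) \<subseteq> H j"
      using eq nbc_snoc(1) by auto
    then have "k \<le> j" "j \<le> k"
      using hyps(5)[OF nbc_snoc(3)] nbc_snoc(6)[OF hyps(2)] by simp_all
    then have "k = j" by simp
    then have "refl_prod (js @ [j]) = refl_prod (ks' @ [j])"
      using prod_eq nbc_snoc(1) by (simp only:)
    from IH[OF nbc_snoc(2) refl_prod_snoc_cancel[OF hyps(2) this]]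
    show ?thesis
      using nbc_snoc(1) \<open>k = j\<close> by simp
  qed
qed

section \<open>Chains of flats and their labels\<close>

lemma nbc_bound:
  assumes "nbc js" "i < length ss" "flat js \<subseteq> H i"
  shows "js \<noteq> [] \<and> i \<le> last js"
  using assms not_V_subset_H by (cases rule: nbc.cases) auto

text \<open>Hyperplanes are ordered against their indices, so the minimum sits at the largest
  index.\<close>

lemma edge_label_eq:
  assumes j: "j < length ss" "Y \<subseteq> H j" "\<not> X \<subseteq> H j"
    and max: "\<And>i. i < length ss \<Longrightarrow> Y \<subseteq> H i \<Longrightarrow> \<not> X \<subseteq> H i \<Longrightarrow> i \<le> j"
  shows "edge_label n ss X Y = H j"
proof -
  let ?Hs = "{K \<in> arrangement n ss. Y \<subseteq> K \<and> \<not> X \<subseteq> K}"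
  have Hs: "K \<in> ?Hs \<longleftrightarrow> (\<exists>i < length ss. K = H i \<and> Y \<subseteq> H i \<and> \<not> X \<subseteq> H i)" for K
    unfolding arrangement_def by blast
  show ?thesis
    unfolding edge_label_def Let_def
  proof (rule the_equality, goal_cases)
    case 1
    show ?case
    proof (intro conjI ballI impI)
      show "H j \<in> ?Hs"
        unfolding Hs using j by blast
    next
      fix K assume "K \<in> ?Hs" "K \<noteq> H j"
      then obtain i where "i < length ss" "K = H i" "i \<le> j"
        unfolding Hs using max by blast
      moreover from this have "i < j"
        using \<open>K \<noteq> H j\<close> by (auto simp: le_less)
      ultimately show "hyp_greater n ss K (H j)"
        using j(1) unfolding hyp_greater_def by blast
    qed
  next
    case (2 K)
    then obtain k where k: "k < length ss" "K = H k" "k \<le> j"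
      unfolding Hs using max by blast
    show ?case
    proof (rule ccontr)
      assume "K \<noteq> H j"
      moreover have "H j \<in> ?Hs"
        unfolding Hs using j by blast
      ultimately have "hyp_greater n ss (H j) K"
        using 2 by blast
      then obtain i i' where "i < i'" "i' < length ss" "H j = H i" "H k = H i'"
        unfolding hyp_greater_def k(2) by blast
      then have "j < k"
        using H_eq_iff[of j i] H_eq_iff[of k i'] j(1) k(1) by simp
      then show False
        using k by simp
    qed
  qed
qed

lemma flat_in_lattice:
  "set js \<subseteq> {..<length ss} \<Longrightarrow> flat js \<in> intersection_lattice n ss"
  unfolding intersection_lattice_def flat_def arrangement_def
  by (auto intro!: exI[of _ "H ` set js"])

lemma lattice_hyperplane:
  assumes "C \<in> intersection_lattice n ss" "X \<subseteq> V n" "\<not> X \<subseteq> C"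
  obtains i where "i < length ss" "C \<subseteq> H i" "\<not> X \<subseteq> H i"
proof -
  obtain \<B> where B: "\<B> \<subseteq> arrangement n ss" "C = V n \<inter> \<Inter>\<B>"
    using assms(1) by (auto simp: intersection_lattice_def)
  obtain x where "x \<in> X" "x \<notin> C"
    using assms(3) by auto
  then obtain K where "K \<in> \<B>" "x \<notin> K"
    using assms(2) B(2) by auto
  moreover from this obtain i where "i < length ss" "K = H i"
    using B(1) by (auto simp: arrangement_def)
  ultimately show ?thesis
    using that[of i] B(2) \<open>x \<in> X\<close> by auto
qed

lemma flat_iff:
  "set js \<subseteq> {..<length ss} \<Longrightarrow>
    x \<in> flat js \<longleftrightarrow> x \<in> V n \<and> (\<forall>j \<in> set js. x (lo j) = x (hi j))"
  using H_eq by (fastforce simp: flat_def)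

lemma flat_diff:
  assumes "set js \<subseteq> {..<length ss}" "x \<in> flat js" "y \<in> flat js"
  shows "(\<lambda>i. x i - c * y i) \<in> flat js"
proof -
  have "x \<in> V n" "y \<in> V n"
    using assms(2,3) flat_subset_V by blast+
  then have "(\<lambda>i. x i - c * y i) \<in> V n"
    by (auto simp: V_def sum_subtractf simp flip: sum_distrib_left)
  then show ?thesis
    using assms(2,3) unfolding flat_iff[OF assms(1)] by simp
qed

lemma covers_flat_snoc:
  assumes js: "set js \<subseteq> {..<length ss}" and j: "j < length ss" "\<not> flat js \<subseteq> H j"
  shows "covers n ss (flat js) (flat (js @ [j]))"
proof -
  have "C = flat js"
    if C: "C \<in> intersection_lattice n ss" "flat (js @ [j]) \<subset> C" "C \<subseteq> flat js" for C
  proof (rule ccontr)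
    assume "C \<noteq> flat js"
    then have "\<not> flat js \<subseteq> C"
      using C(3) by auto
    then obtain i where i: "i < length ss" "C \<subseteq> H i" "\<not> flat js \<subseteq> H i"
      by (rule lattice_hyperplane[OF C(1) flat_subset_V])
    obtain y where y: "y \<in> flat js" "y \<notin> H i"
      using i by auto
    have yi: "y (lo i) \<noteq> y (hi i)"
      using y H_eq[OF i(1)] flat_subset_V[of js] by auto
    obtain x where x: "x \<in> C" "x \<notin> flat (js @ [j])"
      using C by auto
    then have xj: "x (lo j) \<noteq> x (hi j)" and xi: "x (lo i) = x (hi i)" and xf: "x \<in> flat js"
      using C(3) i H_eq flat_subset_V[of js] j by auto
    \<comment> \<open>\<open>c\<close> is chosen to put \<open>z\<close> into \<open>H j\<close>.
      Then \<open>z\<close> lies in \<open>flat (js @ [j])\<close>, hence in \<open>C\<close> and in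
      \<open>H i\<close>; as \<open>x\<close> lies in \<open>H i\<close>, so would
      \<open>y\<close>.\<close>
    define c where "c = (y (lo j) - y (hi j)) / (x (lo j) - x (hi j))"
    define z where "z i = y i - c * x i" for i
    have z: "z \<in> flat js"
      unfolding z_def using flat_diff[OF js y(1) xf] .
    have "z (lo j) - z (hi j) = (y (lo j) - y (hi j)) - c * (x (lo j) - x (hi j))"
      by (simp add: z_def algebra_simps)
    also have "\<dots> = 0"
      using xj by (simp add: c_def)
    finally have "z \<in> H j"
      using z flat_subset_V H_eq[OF j(1)] by auto
    then have "z \<in> H i"
      using z C i by auto
    then have "z (lo i) = z (hi i)"
      using H_eq[OF i(1)] by auto
    then show False
      using xi yi by (simp add: z_def)
  qed
  then show ?thesis
    using flat_in_lattice[of js] flat_in_lattice[of "js @ [j]"] js j unfolding covers_def by auto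
qed

definition chain_of :: "nat list \<Rightarrow> (nat \<Rightarrow> real) set list"
  where "chain_of js = map (\<lambda>i. flat (take i js)) [0..<Suc (length js)]"

lemma chain_of_Nil [simp]: "chain_of [] = [V n]"
  by (simp add: chain_of_def)

lemma chain_of_snoc: "chain_of (js @ [j]) = chain_of js @ [flat (js @ [j])]"
  by (simp add: chain_of_def)

lemma chain_of_neq_Nil [simp]: "chain_of js \<noteq> []"
  by (simp add: chain_of_def)

lemma last_chain_of [simp]: "last (chain_of js) = flat js"
  by (simp add: chain_of_def)

lemma chain_of_nbc:
  "nbc js \<Longrightarrow> chain_of js \<in> decreasing_chains n ss \<and>
    chain_labels n ss (chain_of js) = map H js"
proof (induction rule: nbc.induct)
  case nbc_Nil
  then show ?case
    by (simp add: decreasing_chains_def chain_labels_def)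
next
  case (nbc_snoc js j)
  have label: "edge_label n ss (flat js) (flat (js @ [j])) = H j"
    using nbc_snoc by (intro edge_label_eq) auto
  moreover have "covers n ss (flat js) (flat (js @ [j]))"
    using nbc_snoc nbc_subset by (intro covers_flat_snoc) auto
  moreover have "hyp_greater n ss (last (map H js)) (H j)" if "js \<noteq> []"
    using that nbc_snoc unfolding hyp_greater_def
    by (intro exI[of _ "last js"] exI[of _ j]) (simp add: last_map)
  ultimately show ?case
    using nbc_snoc by (simp add: chain_of_snoc decreasing_chains_snoc chain_labels_snoc del: flat_snoc)
qed

text \<open>Let \<open>j\<close> be the largest index of a hyperplane containing \<open>Y\<close>
  but not its predecessor. Cutting the predecessor by \<open>H j\<close> gives a flat between the
  two, so the covering relation makes it \<open>Y\<close>.\<close>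

lemma decreasing_chain_is_chain_of:
  "Xs \<in> decreasing_chains n ss \<Longrightarrow> \<exists>js. nbc js \<and> Xs = chain_of js"
proof (induction Xs rule: rev_induct)
  case Nil
  then show ?case by (simp add: decreasing_chains_def)
next
  case (snoc Y Xs)
  show ?case
  proof (cases "Xs = []")
    case True
    then show ?thesis
      using snoc.prems by (intro exI[of _ "[]"]) (simp add: decreasing_chains_def nbc_Nil)
  next
    case False
    then have Xs: "Xs \<in> decreasing_chains n ss" and cov: "covers n ss (last Xs) Y"
      and gr: "chain_labels n ss Xs \<noteq> [] \<longrightarrow>
        hyp_greater n ss (last (chain_labels n ss Xs)) (edge_label n ss (last Xs) Y)"
      using snoc.prems by (auto simp: decreasing_chains_snoc)
    obtain js where js: "nbc js" "Xs = chain_of js"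
      using snoc.IH[OF Xs] by auto
    have labels: "chain_labels n ss Xs = map H js"
      using chain_of_nbc js by auto
    have cov: "Y \<in> intersection_lattice n ss" "Y \<subset> flat js"
      "\<And>C. C \<in> intersection_lattice n ss \<Longrightarrow> Y \<subset> C \<Longrightarrow> C \<subset> flat js \<Longrightarrow> False"
      using cov js by (auto simp: covers_def)
    define J where "J = {i. i < length ss \<and> Y \<subseteq> H i \<and> \<not> flat js \<subseteq> H i}"
    have "\<not> flat js \<subseteq> Y"
      using cov(2) by auto
    then obtain i where "i < length ss" "Y \<subseteq> H i" "\<not> flat js \<subseteq> H i"
      by (rule lattice_hyperplane[OF cov(1) flat_subset_V])
    then have J: "J \<noteq> {}" "finite J"
      by (auto simp: J_def)
    define j where "j = Max J"
    have j: "j < length ss" "Y \<subseteq> H j" "\<not> flat js \<subseteq> H j"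
      using Max_in[OF J(2,1)] by (auto simp: j_def J_def)
    have max: "i \<le> j" if "i < length ss" "Y \<subseteq> H i" "\<not> flat js \<subseteq> H i" for i
      using that Max_ge[OF J(2)] by (auto simp: j_def J_def)
    have label: "edge_label n ss (flat js) Y = H j"
      using j max by (rule edge_label_eq)
    have Y: "flat (js @ [j]) = Y"
    proof (rule ccontr)
      assume "\<not> ?thesis"
      then have "Y \<subset> flat (js @ [j])"
        using cov j by auto
      moreover have "flat (js @ [j]) \<subset> flat js"
        using j by auto
      moreover have "set (js @ [j]) \<subseteq> {..<length ss}"
        using nbc_subset[OF js(1)] j by auto
      ultimately show False
        using cov(3)[OF flat_in_lattice] by blast
    qed
    have last: "last js < j" if "js \<noteq> []"
    proof -
      have "hyp_greater n ss (H (last js)) (H j)"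
        using gr labels label that js by (simp add: last_map)
      then obtain i i' where "i < i'" "i' < length ss" "H (last js) = H i" "H j = H i'"
        by (auto simp: hyp_greater_def)
      moreover have "last js < length ss"
        using nbc_subset[OF js(1)] last_in_set[OF that] by blast
      ultimately show ?thesis
        using H_eq_iff[of "last js" i] H_eq_iff[of j i'] j(1) by simp
    qed
    have "nbc (js @ [j])"
    proof (rule nbc_snoc[OF js(1) j(1) _ j(3)])
      fix i assume i: "i \<in> set js"
      then have "i \<le> last js"
        using nbc_bound[OF js(1), of i] nbc_subset[OF js(1)] flat_subset_H by auto
      then show "i < j"
        using last i by fastforce
    next
      fix i assume i: "i < length ss" "flat (js @ [j]) \<subseteq> H i"
      \<comment> \<open>A hyperplane containing the old flat has index at most
        \<open>last js\<close>, which is below \<open>j\<close> because the labels decrease; a new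
        one is bounded by the choice of \<open>j\<close>.\<close>
      show "i \<le> j"
      proof (cases "flat js \<subseteq> H i")
        case True
        then show ?thesis
          using nbc_bound[OF js(1) i(1)] last by auto
      next
        case False
        then show ?thesis using max i Y by simp
      qed
    qed
    then show ?thesis
      using Y js by (intro exI[of _ "js @ [j]"]) (simp add: chain_of_snoc)
  qed
qed

lemma phi_chain_of:
  assumes "nbc js"
  shows "\<phi> n ss w (chain_of js) = w \<circ> refl_prod js"
proof -
  have "refl_of_hyp n ss (H j) = r j" if "j < length ss" for j
  proof -
    have "(THE i. i < length ss \<and> H j = H i) = j"
      using that H_inj by (intro the_equality) (auto dest: inj_onD)
    then show ?thesis by (simp add: refl_of_hyp_def)
  qed
  then have "map (refl_of_hyp n ss) (map H js) = map r js"
    using nbc_subset[OF assms] by auto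
  moreover have "chain_labels n ss (chain_of js) = map H js"
    using chain_of_nbc[OF assms] by blast
  ultimately show ?thesis
    by (simp only: \<phi>_def chain_prod_def perm_mult_def refl_prod_def)
qed

section \<open>Injectivity, and inclusion of the image in the Bruhat interval\<close>

lemma decreasing_chains_eq: "decreasing_chains n ss = chain_of ` {js. nbc js}"
  using chain_of_nbc decreasing_chain_is_chain_of by auto

lemma phi_image: "\<phi> n ss w ` decreasing_chains n ss = (\<lambda>js. w \<circ> refl_prod js) ` {js. nbc js}"
  unfolding decreasing_chains_eq image_image using phi_chain_of by auto

lemma phi_inj: "inj_on (\<phi> n ss w) (decreasing_chains n ss)"
proof -
  have "js = ks" if "nbc js" "nbc ks" "w \<circ> refl_prod js = w \<circ> refl_prod ks" for js ks
    using that nbc_refl_prod_inj fun.inj_map_strong[of "refl_prod js" "refl_prod ks" w w]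
      permutes_inj[OF perm] by (metis fun.inj_map injD)
  then show ?thesis
    unfolding decreasing_chains_eq inj_on_def using phi_chain_of by auto
qed

text \<open>Deletions at larger indices leave the prefix up to the smallest index \<open>j\<close>
  intact, so \<open>r j\<close> then deletes its own letter. Hence the induction carries an
  untouched prefix of length \<open>l\<close>.\<close>

lemma subword_of_sorted:
  assumes "sorted_wrt (<) js" "set js \<subseteq> {l..<length ss}" "l \<le> length ss"
  shows "\<exists>us. subseq us (drop l ss) \<and>
    w \<circ> refl_prod js = perm_prod us \<circ> perm_prod (take l ss)"
  using assms
proof (induction js arbitrary: l)
  case Nil
  have "perm_prod (take l ss @ drop l ss) = w"
    by (simp only: append_take_drop_id perm_prod_ss)
  then show ?case
    by (intro exI[of _ "drop l ss"])
      (simp only: perm_prod_append refl_prod_Nil comp_id subseq_order.order_refl simp_thms)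
next
  case (Cons j js)
  have j: "j < length ss" "l \<le> j" and "set js \<subseteq> {Suc j..<length ss}"
    using Cons.prems by (fastforce simp: Suc_le_eq subset_iff)+
  then obtain us where us: "subseq us (drop (Suc j) ss)"
    "w \<circ> refl_prod js = perm_prod us \<circ> perm_prod (take (Suc j) ss)"
    using Cons.IH[of "Suc j"] Cons.prems(1) by (metis Suc_leI sorted_wrt.simps(2))
  have "w \<circ> refl_prod (j # js) = w \<circ> refl_prod js \<circ> r j"
    by (simp add: refl_prod_def o_assoc)
  also have "\<dots> = perm_prod us \<circ> (perm_prod (take (Suc j) ss) \<circ> refl_at (take (Suc j) ss) j)"
    using us j by (simp add: refl_at_take comp_assoc)
  also have "perm_prod (take (Suc j) ss) \<circ> refl_at (take (Suc j) ss) j = perm_prod (take j ss)"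
    using perm_prod_delete[OF take_subset_simple[OF ss_simple, of "Suc j"], of j] j
    by (simp add: min_def)
  also have "take j ss = take l ss @ take (j - l) (drop l ss)"
    using j by (metis le_add_diff_inverse take_add)
  finally have "w \<circ> refl_prod (j # js) =
      perm_prod (take (j - l) (drop l ss) @ us) \<circ> perm_prod (take l ss)"
    by (simp only: perm_prod_append comp_assoc)
  moreover have "subseq (take (j - l) (drop l ss) @ us) (drop l ss)"
  proof -
    have "drop l ss = take (j - l) (drop l ss) @ ss ! j # drop (Suc j) ss"
      using j by (metis Cons_nth_drop_Suc append_take_drop_id drop_drop le_add_diff_inverse2)
    moreover have "subseq us (ss ! j # drop (Suc j) ss)"
      using us by (simp add: list_emb_Cons)
    ultimately show ?thesis
      by (metis subseq_append')
  qed
  ultimately show ?case by blast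
qed

lemma phi_image_subset: "\<phi> n ss w ` decreasing_chains n ss \<subseteq> bruhat_interval n w"
proof -
  have "w \<circ> refl_prod js \<in> bruhat_interval n w" if nbc: "nbc js" for js
  proof -
    obtain us where "subseq us ss" "w \<circ> refl_prod js = perm_prod us"
      using subword_of_sorted[of js 0] nbc_sorted[OF nbc] nbc_subset[OF nbc]
      by (auto simp: atLeast0LessThan)
    moreover have "w \<circ> refl_prod js permutes {1..n}"
      using refl_prod_permutes[OF nbc_subset[OF nbc]] perm by (rule permutes_compose)
    ultimately show ?thesis
      using red by (auto simp: bruhat_interval_def bruhat_le_def)
  qed
  then show ?thesis
    unfolding phi_image by auto
qed

end

section \<open>Surjectivity for permutations avoiding the patterns\<close>

text \<open>Negating positions and values reverses both orders, which turns \<open>p\<close> into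
  its reverse complement \<open>q\<close>.\<close>

lemma pattern_at_reflect:
  assumes xs: "pattern_at ((\<lambda>i. - int i) ` {1..n}) (\<lambda>x. - int (w (nat (- x)))) p xs"
    and pq: "length p = length q"
      "\<forall>a < length q. \<forall>b < length q.
        p ! (length q - Suc a) < p ! (length q - Suc b) \<longleftrightarrow> q ! b < q ! a"
  shows "pattern_at {1..n} w q (rev (map (\<lambda>x. nat (- x)) xs))"
proof -
  let ?D = "(\<lambda>i. - int i) ` {1..n}"
  have len: "length xs = length q" and sorted: "sorted_wrt (<) xs" and D: "set xs \<subseteq> ?D"
    and ord: "\<And>a b. a < length q \<Longrightarrow> b < length q \<Longrightarrow>
      w (nat (- (xs ! b))) < w (nat (- (xs ! a))) \<longleftrightarrow> p ! a < p ! b"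
    using xs pq(1) by (auto simp: pattern_at_def)
  have nonpos: "x < 0" if "x \<in> set xs" for x
    using that D by auto
  have "sorted_wrt (<) (rev (map (\<lambda>x. nat (- x)) xs))"
    using sorted nonpos by (auto simp: sorted_wrt_rev sorted_wrt_map intro: sorted_wrt_mono_rel[rotated])
  moreover have "set (rev (map (\<lambda>x. nat (- x)) xs)) \<subseteq> {1..n}"
    using D by auto
  moreover have "w (rev (map (\<lambda>x. nat (- x)) xs) ! a) < w (rev (map (\<lambda>x. nat (- x)) xs) ! b)
      \<longleftrightarrow> q ! a < q ! b" if "a < length q" "b < length q" for a b
    using that len pq(2) ord[of "length q - Suc b" "length q - Suc a"]
    by (simp add: rev_nth)
  ultimately show ?thesis
    using len by (simp add: pattern_at_def)
qed

text \<open>\<open>w\<close> fixes 0 and everything above \<open>n\<close>, and these points are too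
  low or too high to be witnesses.\<close>

lemma in_hull_in_range:
  assumes w: "w permutes {1..n}" and u: "u permutes {1..n}" and hull: "in_hull w u"
    and i: "i \<in> {1..n}"
  shows "\<exists>i' \<in> {1..n}. i' \<le> i \<and> u i \<le> w i'" and "\<exists>i' \<in> {1..n}. i \<le> i' \<and> w i' \<le> u i"
proof -
  have ui: "u i \<in> {1..n}"
    using permutes_in_image[OF u] i by blast
  obtain i' where i': "i' \<le> i" "u i \<le> w i'"
    using hull by (auto simp: in_hull_def)
  have "i' \<noteq> 0"
    using i' ui permutes_not_in[OF w, of 0] by (intro notI) auto
  then show "\<exists>i' \<in> {1..n}. i' \<le> i \<and> u i \<le> w i'"
    using i' i by (intro bexI[of _ i']) auto
  obtain k where k: "i \<le> k" "w k \<le> u i"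
    using hull by (auto simp: in_hull_def)
  have "k \<le> n"
    using k ui permutes_not_in[OF w, of k] by (intro leI notI) auto
  then show "\<exists>i' \<in> {1..n}. i \<le> i' \<and> w i' \<le> u i"
    using k i by (intro bexI[of _ k]) auto
qed

locale avoiding_permutation =
  fixes n :: nat and w :: "nat \<Rightarrow> nat"
  assumes w_permutes: "w permutes {1..n}"
    and avoids: "avoids n w [4,2,3,1]" "avoids n w [3,5,1,4,2]"
      "avoids n w [4,2,5,1,3]" "avoids n w [3,5,1,6,2,4]"

sublocale avoiding_permutation \<subseteq> avoiding "{1..n}" w
  using permutes_inj_on[OF w_permutes] avoids
  by unfold_locales (auto simp: avoids_iff_no_pattern_at)

sublocale avoiding_permutation \<subseteq>
  dual: avoiding "(\<lambda>i. - int i) ` {1..n}" "\<lambda>x. - int (w (nat (- x)))"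
proof unfold_locales
  show "inj_on (\<lambda>x. - int (w (nat (- x)))) ((\<lambda>i. - int i) ` {1..n})"
    using permutes_inj[OF w_permutes] by (auto simp: inj_on_def dest: injD)
next
  fix xs
  show "\<not> pattern_at ((\<lambda>i. - int i) ` {1..n}) (\<lambda>x. - int (w (nat (- x)))) [4,2,3,1] xs"
    using pattern_at_reflect[where w = w and p = "[4,2,3,1]" and q = "[4,2,3,1]"] no4231
    by (force simp: All_less_Suc numeral_eq_Suc)
  show "\<not> pattern_at ((\<lambda>i. - int i) ` {1..n}) (\<lambda>x. - int (w (nat (- x)))) [3,5,1,4,2] xs"
    using pattern_at_reflect[where w = w and p = "[3,5,1,4,2]" and q = "[4,2,5,1,3]"] no42513
    by (force simp: All_less_Suc numeral_eq_Suc)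
  show "\<not> pattern_at ((\<lambda>i. - int i) ` {1..n}) (\<lambda>x. - int (w (nat (- x)))) [4,2,5,1,3] xs"
    using pattern_at_reflect[where w = w and p = "[4,2,5,1,3]" and q = "[3,5,1,4,2]"] no35142
    by (force simp: All_less_Suc numeral_eq_Suc)
  show "\<not> pattern_at ((\<lambda>i. - int i) ` {1..n}) (\<lambda>x. - int (w (nat (- x)))) [3,5,1,6,2,4] xs"
    using pattern_at_reflect[where w = w and p = "[3,5,1,6,2,4]" and q = "[3,5,1,6,2,4]"] no351624
    by (force simp: All_less_Suc numeral_eq_Suc)
qed

context avoiding_permutation
begin

text \<open>Only two values of \<open>u\<close> change. At \<open>c\<close> the value rises to
  \<open>w a\<close>, which needs a higher witness on the left; at \<open>d\<close> it drops to
  \<open>w b\<close>, which needs a lower one on the right. These come from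
  \<open>swap_upper_bound\<close> and its dual.\<close>

lemma in_hull_transpose:
  assumes u: "u permutes {1..n}" and hull: "in_hull w u"
    and B: "B \<subseteq> {1..n}" "u ` B = w ` B"
    and ab: "a \<in> B" "b \<in> B" "a < b" "w b < w a"
    and adj: "\<And>x. x \<in> B \<Longrightarrow> w x \<le> w b \<or> w a \<le> w x"
  shows "in_hull w (transpose (w a) (w b) \<circ> u)"
proof -
  note hull1 = in_hull_in_range(1)[OF w_permutes u hull]
    and hull2 = in_hull_in_range(2)[OF w_permutes u hull]
  have finB: "finite B"
    using B(1) by (rule finite_subset) simp
  have injB: "inj_on u B"
    using permutes_inj_on[OF u] .
  obtain c where c: "c \<in> B" "u c = w b"
    using B(2) ab(2) by (metis imageE imageI)
  obtain d where d: "d \<in> B" "u d = w a"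
    using B(2) ab(1) by (metis imageE imageI)
  have low: "\<exists>i \<in> {1..n}. i \<le> c \<and> w a \<le> w i"
    by (rule swap_upper_bound[OF B(1) finB B(2) injB hull1 hull2 ab adj c])
  have high: "\<exists>i \<in> {1..n}. d \<le> i \<and> w i \<le> w b"
  proof -
    let ?f = "\<lambda>i. - int i"
    let ?u = "\<lambda>x. - int (u (nat (- x)))"
    \<comment> \<open>Negation exchanges the roles of \<open>a\<close> and \<open>b\<close>, and
      \<open>d\<close> takes that of \<open>c\<close>.\<close>
    have "\<exists>i \<in> ?f ` {1..n}. i \<le> ?f d \<and> - int (w (nat (- ?f b))) \<le> - int (w (nat (- i)))"
    proof (rule dual.swap_upper_bound[where u = ?u and B = "?f ` B" and b = "?f a"])
      show "?u ` ?f ` B = (\<lambda>x. - int (w (nat (- x)))) ` ?f ` B"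
        using arg_cong[OF B(2), of "image ?f"] by (simp add: image_image)
      show "inj_on ?u (?f ` B)"
        using injB by (auto simp: inj_on_def)
      show "\<exists>i' \<in> ?f ` {1..n}. i' \<le> i \<and> ?u i \<le> - int (w (nat (- i')))"
        if "i \<in> ?f ` {1..n}" for i
        using that hull2 by fastforce
      show "\<exists>i' \<in> ?f ` {1..n}. i \<le> i' \<and> - int (w (nat (- i'))) \<le> ?u i"
        if "i \<in> ?f ` {1..n}" for i
        using that hull1 by fastforce
      show "- int (w (nat (- x))) \<le> - int (w (nat (- ?f a))) \<or>
          - int (w (nat (- ?f b))) \<le> - int (w (nat (- x)))" if "x \<in> ?f ` B" for x
        using that adj by fastforce
    qed (use B finB ab d in auto)
    then show ?thesis by auto
  qed
  have "c \<noteq> d"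
    using c d ab by auto
  have inj: "inj u"
    using permutes_inj[OF u] .
  have z: "(transpose (w a) (w b) \<circ> u) i = (if i = c then w a else if i = d then w b else u i)" for i
    using c d inj_eq[OF inj, of i] by (metis comp_apply transpose_apply_first
        transpose_apply_other transpose_apply_second)
  have hull_lo: "\<exists>i' \<le> i. u i \<le> w i'" and hull_hi: "\<exists>i' \<ge> i. w i' \<le> u i" for i
    using hull by (auto simp: in_hull_def)
  obtain c1 c2 d1 d2 where cd: "c1 \<le> c" "w b \<le> w c1" "c \<le> c2" "w c2 \<le> w b"
    "d1 \<le> d" "w a \<le> w d1" "d \<le> d2" "w d2 \<le> w a"
    using hull_lo[of c] hull_hi[of c] hull_lo[of d] hull_hi[of d] c d by auto
  have "(\<exists>i' \<le> c. w a \<le> w i') \<and> (\<exists>i' \<ge> c. w i' \<le> w a)"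
    using low cd ab(4) by (meson less_imp_le order_trans)
  moreover have "(\<exists>i' \<le> d. w b \<le> w i') \<and> (\<exists>i' \<ge> d. w i' \<le> w b)"
    using high cd ab(4) by (meson less_imp_le order_trans)
  ultimately show ?thesis
    unfolding in_hull_def z using hull_lo hull_hi by simp
qed

end

section \<open>Splitting a cycle by a transposition of two of its points\<close>

lemma center_indicator_fixed:
  assumes p: "p permutes {1..n}" and S: "S \<subseteq> {1..n}" "p ` S \<subseteq> S"
  shows "center n (indicator S) \<circ> p = center n (indicator S)"
proof (rule center_comp[OF p])
  fix i
  have "p ` S = S"
    by (rule endo_inj_surj[OF finite_subset[OF S(1)] S(2) permutes_inj_on[OF p]]) simp
  then have "p i \<in> S \<longleftrightarrow> i \<in> S"
    using inj_image_mem_iff[OF permutes_inj[OF p], of i S] by simp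
  then show "indicator S (p i) = (indicator S i :: real)"
    by (simp add: indicator_def)
qed

lemma center_indicator_eq_iff:
  "a \<in> {1..n} \<Longrightarrow> b \<in> {1..n} \<Longrightarrow>
    center n (indicator S) a = center n (indicator S) b \<longleftrightarrow> (a \<in> S \<longleftrightarrow> b \<in> S)"
  by (simp add: center_eq_iff indicator_def)

text \<open>The arc of the cycle that starts at \<open>a\<close> and stops before \<open>b\<close> becomes invariant.\<close>

lemma transpose_splits_cycle:
  assumes p: "p permutes {1..n}" and ab: "a \<in> {1..n}" "b \<in> {1..n}" "a \<noteq> b"
    and same: "\<And>f. f \<in> V n \<Longrightarrow> f \<circ> p = f \<Longrightarrow> f a = f b"
  shows "\<exists>f \<in> V n. f \<circ> (transpose a b \<circ> p) = f \<and> f a \<noteq> f b"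
proof -
  have range: "(p ^^ i) a \<in> {1..n}" for i
    by (induction i) (use ab(1) permutes_in_image[OF p] in auto)
  define orb where "orb = range (\<lambda>i. (p ^^ i) a)"
  have "orb \<subseteq> {1..n}"
    using range by (auto simp: orb_def)
  moreover have "p ` orb \<subseteq> orb"
  proof -
    have "p ((p ^^ i) a) = (p ^^ Suc i) a" for i by simp
    then show ?thesis unfolding orb_def by blast
  qed
  moreover have "a \<in> orb"
    using rangeI[of "\<lambda>i. (p ^^ i) a" 0] by (simp add: orb_def)
  \<comment> \<open>The centred indicator of the orbit of \<open>a\<close> is a fixed vector, so it
    agrees at \<open>a\<close> and \<open>b\<close>.\<close>
  ultimately have "b \<in> orb"
    using same[OF center_in_V center_indicator_fixed[OF p, of orb]]
      center_indicator_eq_iff[OF ab(1,2), of orb] by simp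
  then have ex: "\<exists>i. (p ^^ i) a = b"
    by (auto simp: orb_def)
  define k where "k = (LEAST i. (p ^^ i) a = b)"
  have k: "(p ^^ k) a = b"
    unfolding k_def using ex by (rule LeastI_ex)
  have least: "(p ^^ i) a \<noteq> b" if "i < k" for i
    using that not_less_Least unfolding k_def by blast
  have "k \<noteq> 0"
    using k ab(3) by (intro notI) simp
  define S where "S = (\<lambda>i. (p ^^ i) a) ` {..<k}"
  have S: "a \<in> S" "b \<notin> S"
  proof -
    show "a \<in> S"
      unfolding S_def using \<open>k \<noteq> 0\<close> by (intro image_eqI[of _ _ 0]) simp_all
    show "b \<notin> S"
      unfolding S_def using least by blast
  qed
  have tp: "transpose a b \<circ> p permutes {1..n}"
    using p permutes_swap_id[OF ab(1,2)] by (rule permutes_compose)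
  have "(transpose a b \<circ> p) ` S \<subseteq> S"
  proof
    fix y assume "y \<in> (transpose a b \<circ> p) ` S"
    then obtain i where i: "i < k" "y = transpose a b ((p ^^ Suc i) a)"
      by (auto simp: S_def)
    show "y \<in> S"
    proof (cases "Suc i = k")
      case True
      then have "y = a" using i(2) k by simp
      then show ?thesis using S(1) by simp
    next
      case False
      then have less: "Suc i < k" using i by simp
      \<comment> \<open>An early return to \<open>a\<close> would make the cycle meet
        \<open>b\<close> in fewer than \<open>k\<close> steps.\<close>
      have "(p ^^ Suc i) a \<noteq> a"
      proof
        assume eq: "(p ^^ Suc i) a = a"
        have "(p ^^ k) a = (p ^^ (k - Suc i)) ((p ^^ Suc i) a)"
          using less by (metis comp_apply funpow_add le_add_diff_inverse2 less_imp_le)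
        then have "(p ^^ (k - Suc i)) a = b"
          using eq k by simp
        then show False
          using least[of "k - Suc i"] less by simp
      qed
      then have "y = (p ^^ Suc i) a"
        using i(2) least[OF less] by (metis transpose_apply_other)
      then show ?thesis
        using less unfolding S_def by blast
    qed
  qed
  moreover have "S \<subseteq> {1..n}"
    using range by (auto simp: S_def)
  ultimately have "center n (indicator S) \<circ> (transpose a b \<circ> p) = center n (indicator S)"
    using center_indicator_fixed[OF tp] by simp
  moreover have "center n (indicator S) a \<noteq> center n (indicator S) b"
    using center_indicator_eq_iff[OF ab(1,2), of S] S by simp
  ultimately show ?thesis
    using center_in_V by blast
qed

section \<open>Surjectivity by splitting cycles\<close>

context reduced_word
begin

lemma inversion_index:
  assumes "a < b" "w b < w a"
  shows "\<exists>j < length ss. lo j = a \<and> hi j = b"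
proof -
  obtain j where j: "j < length ss" "r j = transpose a b"
    using strong_exchange[OF ss_simple assms(1)] assms(2) perm_prod_ss by auto
  have "lo j = a"
    unfolding lo_def j(2) using assms(1)
    by (intro Least_equality) (auto simp: transpose_def split: if_splits)
  then show ?thesis
    using j by (auto simp: hi_def)
qed

text \<open>The induction counts pairs in a common cycle of \<open>p\<close>. Cycles are described
  by fixed vectors to be comparable with flats; composing with \<open>r j\<close> splits one and
  lowers the count.\<close>

lemma nbc_of_in_hull:
  assumes av: "avoiding_permutation n w"
  shows "p permutes {1..n} \<Longrightarrow> in_hull w (w \<circ> p) \<Longrightarrow> \<exists>js. nbc js \<and> refl_prod js = p"
proof (induction "card {(x, y). x \<in> {1..n} \<and> y \<in> {1..n} \<and>
      (\<forall>f \<in> V n. f \<circ> p = f \<longrightarrow> f x = f y)}" arbitrary: p rule: less_induct)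
  case less
  interpret avoiding_permutation n w by (rule av)
  define E where "E q = {(x, y). x \<in> {1..n} \<and> y \<in> {1..n} \<and>
      (\<forall>f \<in> V n. f \<circ> q = f \<longrightarrow> f x = f y)}" for q
  have fin: "finite (E q)" for q
    by (rule finite_subset[of _ "{1..n} \<times> {1..n}"]) (auto simp: E_def)
  note IH = less.hyps[folded E_def]
  note p = less.prems(1) and hull = less.prems(2)
  \<comment> \<open>\<open>B x\<close> is the cycle through \<open>x\<close>.\<close>
  define B where "B x = {y \<in> {1..n}. \<forall>f \<in> V n. f \<circ> p = f \<longrightarrow> f y = f x}" for x
  have B_sub: "B x \<subseteq> {1..n}" for x
    by (auto simp: B_def)
  have finB: "finite (B x)" for x
    using B_sub by (rule finite_subset) simp
  have wp: "w \<circ> p permutes {1..n}"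
    using p perm by (rule permutes_compose)
  have wpB: "(w \<circ> p) ` B x = w ` B x" for x
  proof -
    have "p ` B x \<subseteq> B x"
    proof
      fix z assume "z \<in> p ` B x"
      then obtain y where y: "y \<in> B x" "z = p y" by auto
      have "f z = f x" if "f \<in> V n" "f \<circ> p = f" for f
      proof -
        have "f z = f y"
          using fun_cong[OF that(2), of y] y(2) by simp
        moreover have "f y = f x"
          using y(1) that unfolding B_def by blast
        ultimately show ?thesis by simp
      qed
      then show "z \<in> B x"
        using y permutes_in_image[OF p, of y] unfolding B_def by simp
    qed
    then have "p ` B x = B x"
      using finB permutes_inj_on[OF p] by (metis endo_inj_surj)
    then show ?thesis by (metis image_comp)
  qed
  show ?case
  proof (cases "p = id")
    case True
    then show ?thesis
      using nbc_Nil by (intro exI[of _ "[]"]) simp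
  next
    case False
    then obtain x0 where x0: "p x0 \<noteq> x0" by (auto simp: fun_eq_iff)
    then have x0_range: "x0 \<in> {1..n}"
      using permutes_not_in[OF p] by blast
    have x0_B: "x0 \<in> B x0"
      using x0_range by (auto simp: B_def)
    have moved: "(w \<circ> p) x0 \<noteq> w x0"
      using x0 permutes_inj[OF perm] by (auto dest: injD)
    have "\<exists>a \<in> B x0. \<exists>b \<in> B x0. a < b \<and> w b < w a"
      using in_hull_in_range[OF perm wp hull]
      by (rule block_has_inversion[OF B_sub finB wpB permutes_inj_on[OF wp] x0_B moved])
    then obtain a0 b0 where ab0: "a0 \<in> B x0" "b0 \<in> B x0" "a0 < b0" "w b0 < w a0"
      by blast
    \<comment> \<open>These are the indices of the inversions with both ends in one cycle; the
      largest must be the last index of the list.\<close>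
    define J where "J = {i. i < length ss \<and> (\<forall>f \<in> V n. f \<circ> p = f \<longrightarrow> f \<in> H i)}"
    have J_iff: "i \<in> J \<longleftrightarrow> i < length ss \<and> hi i \<in> B (lo i)" for i
    proof (cases "i < length ss")
      case True
      then show ?thesis
        using ends_in_range[OF True] unfolding J_def B_def H_eq[OF True] mem_Collect_eq
        by (metis (no_types, lifting))
    qed (simp add: J_def)
    have J_ex: "\<exists>i \<in> J. lo i = y \<and> hi i = z"
      if yz: "y \<in> B x" "z \<in> B x" "y < z" "w z < w y" for x y z
    proof -
      obtain i where "i < length ss" "lo i = y" "hi i = z"
        using inversion_index[OF yz(3,4)] by blast
      moreover have "z \<in> B y"
      proof -
        have "f z = f y" if "f \<in> V n" "f \<circ> p = f" for f
        proof -
          have "f y = f x" "f z = f x"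
            using yz(1,2) that unfolding B_def by blast+
          then show ?thesis by simp
        qed
        then show ?thesis
          using yz(2) unfolding B_def by blast
      qed
      ultimately show ?thesis
        using J_iff by blast
    qed
    have J: "finite J" "J \<noteq> {}"
      using J_ex[OF ab0] by (auto simp: J_def)
    define j where "j = Max J"
    have "j \<in> J"
      unfolding j_def using J by (rule Max_in)
    have j: "j < length ss" and fixH: "\<And>f. f \<in> V n \<Longrightarrow> f \<circ> p = f \<Longrightarrow> f \<in> H j"
      using \<open>j \<in> J\<close> unfolding J_def by blast+
    have max: "i \<le> j" if "i \<in> J" for i
      unfolding j_def using J(1) that by (rule Max_ge)
    define a b where "a = lo j" and "b = hi j"
    note rj = refl_at_transpose[OF j, folded a_def b_def]
    have range: "a \<in> {1..n}" "b \<in> {1..n}"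
      using ends_in_range[OF j] by (simp_all add: a_def b_def)
    have abB: "a \<in> B a" "b \<in> B a"
      using range(1) \<open>j \<in> J\<close> unfolding J_iff by (simp_all add: B_def a_def b_def)
    let ?v = "perm_prod (take (Suc j) ss)"
    \<comment> \<open>On this cycle the prefix ending with letter \<open>j\<close> already orders
      positions as \<open>w\<close> does: inversions inside the cycle have index at most
      \<open>j\<close>, and none is undone later. As \<open>a\<close> and \<open>b\<close> have
      adjacent values in the prefix, \<open>adj\<close> follows.\<close>
    have v_less: "?v z < ?v y" if yz: "y \<in> B a" "z \<in> B a" "w z < w y" for y z
    proof -
      consider "y < z" | "z < y"
        using yz(3) by (metis linorder_neqE order_less_irrefl)
      then show ?thesis
      proof cases
        case 1
        then obtain i where i: "i \<in> J" "lo i = y" "hi i = z"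
          using J_ex yz by blast
        then have "i < length ss" by (simp add: J_def)
        then have "perm_prod (take (Suc i) ss) z < perm_prod (take (Suc i) ss) y"
          using refl_at_transpose(6)[of i] i by simp
        then show ?thesis
          using reduced_inversion_mono[OF red 1, of "Suc i" "Suc j"] max[OF i(1)] j by simp
      next
        case 2
        have "\<not> ?v y < ?v z"
          using reduced_inversion_mono[OF red 2, of "Suc j" "length ss"] j yz(3) perm_prod_ss
          by auto
        moreover have "?v y \<noteq> ?v z"
          using 2 permutes_inj[OF perm_prod_permutes[OF take_subset_simple[OF ss_simple]]]
          by (metis injD order_less_irrefl)
        ultimately show ?thesis by simp
      qed
    qed
    have adj: "w x \<le> w b \<or> w a \<le> w x" if "x \<in> B a" for x
    proof (rule ccontr)
      assume "\<not> ?thesis"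
      then have "?v b < ?v x" "?v x < ?v a"
        using v_less[OF that abB(2)] v_less[OF abB(1) that] by simp_all
      then show False using rj(6) by simp
    qed
    let ?q = "r j \<circ> p"
    have q: "?q permutes {1..n}"
      using p r_permutes[OF j] by (rule permutes_compose)
    have "transpose (w a) (w b) \<circ> (w \<circ> p) = w \<circ> ?q"
      unfolding rj(1) using inj_eq[OF permutes_inj[OF perm]]
      by (auto simp: fun_eq_iff transpose_def)
    then have hull_q: "in_hull w (w \<circ> ?q)"
      using in_hull_transpose[OF wp hull B_sub wpB abB rj(3,5) adj] by simp
    have fix_q: "f \<circ> ?q = f" if "f \<in> V n" "f \<circ> p = f" for f
    proof -
      have "f \<circ> r j = f"
        using fixH[OF that] in_H_iff[OF j] by blast
      then show ?thesis
        using that(2) by (metis comp_assoc)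
    qed
    have "f a = f b" if "f \<in> V n" "f \<circ> p = f" for f
      using fixH[OF that] unfolding H_eq[OF j] a_def b_def by blast
    then obtain g where g: "g \<in> V n" "g \<circ> ?q = g" "g a \<noteq> g b"
      using transpose_splits_cycle[OF p range] rj(1,3) by (metis less_irrefl)
    have "(a, b) \<in> E p - E ?q"
      using g range abB(2) by (auto simp: E_def B_def)
    moreover have "E ?q \<subseteq> E p"
      using fix_q by (auto simp: E_def)
    ultimately have "card (E ?q) < card (E p)"
      using fin by (intro psubset_card_mono) auto
    then obtain js where js: "nbc js" "refl_prod js = ?q"
      using IH q hull_q by blast
    note flat = flat_nbc[OF js(1), unfolded js(2)]
    have "g \<in> flat js" "g \<notin> H j"
      using g unfolding flat H_eq[OF j] a_def b_def by auto
    then have not_sub: "\<not> flat js \<subseteq> H j" by blast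
    \<comment> \<open>Consequently every hyperplane containing \<open>flat js\<close> has its index
      in \<open>J\<close>.\<close>
    have in_flat: "f \<in> flat js" if "f \<in> V n" "f \<circ> p = f" for f
      unfolding flat using that fix_q by blast
    have "nbc (js @ [j])"
    proof (rule nbc_snoc[OF js(1) j _ not_sub])
      fix i assume i: "i \<in> set js"
      then have "i \<in> J"
        using nbc_subset[OF js(1)] flat_subset_H[OF i] in_flat by (auto simp: J_def)
      moreover have "i \<noteq> j"
        using flat_subset_H[OF i] not_sub by blast
      ultimately show "i < j"
        using max[of i] by simp
    next
      fix i assume "i < length ss" "flat (js @ [j]) \<subseteq> H i"
      then have "i \<in> J"
        using in_flat fixH unfolding J_def flat_snoc by blast
      then show "i \<le> j" by (rule max)
    qed
    moreover have "refl_prod (js @ [j]) = p"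
      using js(2) r_comp_r[OF j] by (metis comp_assoc id_comp refl_prod_snoc)
    ultimately show ?thesis by blast
  qed
qed

lemma avoiding_imp_surjective:
  assumes "avoiding_permutation n w"
  shows "bruhat_interval n w \<subseteq> \<phi> n ss w ` decreasing_chains n ss"
proof
  fix u assume u: "u \<in> bruhat_interval n w"
  then have perm_u: "u permutes {1..n}" and "in_hull w u"
    using bruhat_le_in_hull by (auto simp: bruhat_interval_def)
  have eq: "w \<circ> (inv w \<circ> u) = u"
    using permutes_inv_o(1)[OF perm] by (metis comp_assoc id_comp)
  moreover have "inv w \<circ> u permutes {1..n}"
    using perm_u permutes_inv[OF perm] by (rule permutes_compose)
  ultimately obtain js where "nbc js" "refl_prod js = inv w \<circ> u"
    using nbc_of_in_hull[OF assms, of "inv w \<circ> u"] \<open>in_hull w u\<close> by auto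
  then show "u \<in> \<phi> n ss w ` decreasing_chains n ss"
    unfolding phi_image using eq by (intro image_eqI[of _ _ js]) auto
qed

text \<open>No label joins \<open>K\<close> to its complement, as \<open>K\<close> is invariant, and
  no inversion joins \<open>L\<close> to the rest of \<open>K\<close>. So the centred indicator of
  \<open>L\<close> lies in the flat and is fixed.\<close>

lemma nbc_preserves_component:
  assumes js: "nbc js" and K: "K \<subseteq> {1..n}" "refl_prod js ` K \<subseteq> K" and L: "L \<subseteq> K"
    and sep: "\<And>x y. x \<in> L \<Longrightarrow> y \<in> K - L \<Longrightarrow> x < y \<longleftrightarrow> w x < w y"
  shows "refl_prod js ` L \<subseteq> L"
proof -
  let ?p = "refl_prod js"
  have p: "?p permutes {1..n}"
    using refl_prod_permutes[OF nbc_subset[OF js]] .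
  have flat: "center n (indicator S) \<in> flat js \<longleftrightarrow> (\<forall>j \<in> set js. lo j \<in> S \<longleftrightarrow> hi j \<in> S)" for S
    unfolding flat_iff[OF nbc_subset[OF js]]
    using center_in_V center_indicator_eq_iff[OF ends_in_range] nbc_subset[OF js]
    by (metis lessThan_iff subsetD)
  have "center n (indicator K) \<in> flat js"
    unfolding flat_nbc[OF js] using center_in_V center_indicator_fixed[OF p K] by blast
  then have K_ends: "lo j \<in> K \<longleftrightarrow> hi j \<in> K" if "j \<in> set js" for j
    using that unfolding flat by blast
  have "lo j \<in> L \<longleftrightarrow> hi j \<in> L" if j: "j \<in> set js" for j
  proof -
    have "lo j < hi j" "w (hi j) < w (lo j)"
      using refl_at_transpose[of j] nbc_subset[OF js] j by auto
    then show ?thesis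
      using sep[of "lo j" "hi j"] sep[of "hi j" "lo j"] K_ends[OF j] L by auto
  qed
  then have "center n (indicator L) \<in> flat js"
    unfolding flat by blast
  then have "center n (indicator L) \<circ> ?p = center n (indicator L)"
    unfolding flat_nbc[OF js] by blast
  then have "center n (indicator L) (?p x) = center n (indicator L) x" for x
    by (metis comp_apply)
  moreover have "x \<in> {1..n} \<and> ?p x \<in> {1..n}" if "x \<in> L" for x
    using that L K(1) permutes_in_image[OF p] by blast
  ultimately show ?thesis
    using center_indicator_eq_iff by blast
qed

section \<open>Elements of the interval that the map misses\<close>

lemma subseq_simple: "subseq us ss \<Longrightarrow> set us \<subseteq> simple_refls n"
  using ss_simple by (blast elim: list_emb_set)

definition subword :: "(nat \<Rightarrow> nat) \<Rightarrow> bool"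
  where "subword u \<longleftrightarrow> (\<exists>us. subseq us ss \<and> perm_prod us = u)"

lemma subword_w: "subword w"
  unfolding subword_def using perm_prod_ss by blast

lemma subword_comp_transpose:
  assumes "subword u" "a < b" "u b < u a"
  shows "subword (u \<circ> transpose a b)"
proof -
  obtain us where us: "subseq us ss" "perm_prod us = u"
    using assms(1) by (auto simp: subword_def)
  then obtain vs where "subseq vs us" "perm_prod vs = u \<circ> transpose a b"
    using subword_swap[OF subseq_simple[OF us(1)] assms(2)] assms(3) by auto
  then show ?thesis
    using us(1) unfolding subword_def by (meson subseq_order.order_trans)
qed

text \<open>A preimage would come from an \<open>nbc\<close> list with product \<open>p\<close>,
  because \<open>w\<close> cancels; \<open>nbc_preserves_component\<close> would then make
  \<open>L\<close> invariant.\<close>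

lemma subword_obstruction:
  assumes sub: "subword (w \<circ> p)" and K: "K \<subseteq> {1..n}" "p ` K \<subseteq> K" and L: "L \<subseteq> K"
    and sep: "\<And>x y. x \<in> L \<Longrightarrow> y \<in> K - L \<Longrightarrow> x < y \<longleftrightarrow> w x < w y"
    and not_L: "\<not> p ` L \<subseteq> L"
  shows "\<phi> n ss w ` decreasing_chains n ss \<noteq> bruhat_interval n w"
proof
  assume surj: "\<phi> n ss w ` decreasing_chains n ss = bruhat_interval n w"
  obtain us where us: "subseq us ss" "perm_prod us = w \<circ> p"
    using sub by (auto simp: subword_def)
  have "w \<circ> p permutes {1..n}"
    using perm_prod_permutes[OF subseq_simple[OF us(1)]] us(2) by simp
  then have "w \<circ> p \<in> bruhat_interval n w"
    using us red by (auto simp: bruhat_interval_def bruhat_le_def)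
  then obtain js where js: "nbc js" "w \<circ> p = w \<circ> refl_prod js"
    unfolding surj[symmetric] phi_image by blast
  have "p = refl_prod js"
    using js(2) permutes_inj[OF perm] by (metis fun.inj_map injD)
  then show False
    using nbc_preserves_component[OF js(1) K(1) _ L sep] K(2) not_L by blast
qed

text \<open>In each case below, \<open>?p\<close> permutes the positions of the pattern so that \<open>w \<circ> ?p\<close> is reached
  from \<open>w\<close> by successively undoing inversions, while \<open>K\<close> is a union of cycles of \<open>?p\<close> that \<open>?p\<close>
  connects but the inversions of \<open>w\<close> do not.\<close>

lemma pattern_4231_not_surjective:
  assumes "pattern_at {1..n} w [4,2,3,1] xs"
  shows "\<phi> n ss w ` decreasing_chains n ss \<noteq> bruhat_interval n w"
proof -
  have "length xs = 4"
    using assms by (simp add: pattern_at_def)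
  then obtain a b c d where xs: "xs = [a, b, c, d]"
    by (auto simp: numeral_eq_Suc length_Suc_conv)
  have range: "{a, b, c, d} \<subseteq> {1..n}"
    and pos: "a < b" "b < c" "c < d"
    and val: "w d < w b" "w b < w c" "w c < w a"
    using assms by (auto simp: xs pattern_at_def All_less_Suc numeral_eq_Suc)
  have neq: "a \<noteq> b" "a \<noteq> c" "a \<noteq> d" "b \<noteq> c" "b \<noteq> d" "c \<noteq> d"
    using pos by auto
  have s1: "subword (w \<circ> transpose a b)"
    by (rule subword_comp_transpose[OF subword_w]) (use pos val neq in simp_all)
  have s2: "subword (w \<circ> transpose a b \<circ> transpose a d)"
    by (rule subword_comp_transpose[OF s1]) (use pos val neq in simp_all)
  have s3: "subword (w \<circ> transpose a b \<circ> transpose a d \<circ> transpose b c)"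
    by (rule subword_comp_transpose[OF s2]) (use pos val neq in simp_all)
  have s4: "subword (w \<circ> transpose a b \<circ> transpose a d \<circ> transpose b c \<circ> transpose c d)"
    by (rule subword_comp_transpose[OF s3]) (use pos val neq in simp_all)
  \<comment> \<open>In cycle notation \<open>?p\<close> is (a d)(b c), and
    \<open>w \<circ> ?p\<close> reads 1324 on the pattern.\<close>
  let ?p = "transpose a b \<circ> transpose a d \<circ> transpose b c \<circ> transpose c d"
  have "subword (w \<circ> ?p)"
    using s4 by (simp only: comp_assoc)
  then show ?thesis
    by (rule subword_obstruction[where K = "{b, c}" and L = "{b}"])
      (use range pos val neq in auto)
qed

lemma pattern_35142_not_surjective:
  assumes "pattern_at {1..n} w [3,5,1,4,2] xs"
  shows "\<phi> n ss w ` decreasing_chains n ss \<noteq> bruhat_interval n w"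
proof -
  have "length xs = 5"
    using assms by (simp add: pattern_at_def)
  then obtain a b c d e where xs: "xs = [a, b, c, d, e]"
    by (auto simp: numeral_eq_Suc length_Suc_conv)
  have range: "{a, b, c, d, e} \<subseteq> {1..n}"
    and pos: "a < b" "b < c" "c < d" "d < e"
    and val: "w c < w e" "w e < w a" "w a < w d" "w d < w b"
    using assms by (auto simp: xs pattern_at_def All_less_Suc numeral_eq_Suc)
  have neq: "a \<noteq> b" "a \<noteq> c" "a \<noteq> d" "a \<noteq> e" "b \<noteq> c" "b \<noteq> d" "b \<noteq> e" "c \<noteq> d" "c \<noteq> e" "d \<noteq> e"
    using pos by auto
  have s1: "subword (w \<circ> transpose a c)"
    by (rule subword_comp_transpose[OF subword_w]) (use pos val neq in simp_all)
  have s2: "subword (w \<circ> transpose a c \<circ> transpose b c)"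
    by (rule subword_comp_transpose[OF s1]) (use pos val neq in simp_all)
  have s3: "subword (w \<circ> transpose a c \<circ> transpose b c \<circ> transpose b e)"
    by (rule subword_comp_transpose[OF s2]) (use pos val neq in simp_all)
  have s4: "subword (w \<circ> transpose a c \<circ> transpose b c \<circ> transpose b e \<circ> transpose c d)"
    by (rule subword_comp_transpose[OF s3]) (use pos val neq in simp_all)
  have s5: "subword (w \<circ> transpose a c \<circ> transpose b c \<circ> transpose b e \<circ> transpose c d \<circ> transpose d e)"
    by (rule subword_comp_transpose[OF s4]) (use pos val neq in simp_all)
  \<comment> \<open>In cycle notation \<open>?p\<close> is (a c d)(b e), and
    \<open>w \<circ> ?p\<close> reads 12435. On a, c, d the values of \<open>w\<close> are 3, 1, 4,
    so d is in no inversion.\<close>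
  let ?p = "transpose a c \<circ> transpose b c \<circ> transpose b e \<circ> transpose c d \<circ> transpose d e"
  have "subword (w \<circ> ?p)"
    using s5 by (simp only: comp_assoc)
  then show ?thesis
    by (rule subword_obstruction[where K = "{a, c, d}" and L = "{d}"])
      (use range pos val neq in auto)
qed

lemma pattern_42513_not_surjective:
  assumes "pattern_at {1..n} w [4,2,5,1,3] xs"
  shows "\<phi> n ss w ` decreasing_chains n ss \<noteq> bruhat_interval n w"
proof -
  have "length xs = 5"
    using assms by (simp add: pattern_at_def)
  then obtain a b c d e where xs: "xs = [a, b, c, d, e]"
    by (auto simp: numeral_eq_Suc length_Suc_conv)
  have range: "{a, b, c, d, e} \<subseteq> {1..n}"
    and pos: "a < b" "b < c" "c < d" "d < e"
    and val: "w d < w b" "w b < w e" "w e < w a" "w a < w c"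
    using assms by (auto simp: xs pattern_at_def All_less_Suc numeral_eq_Suc)
  have neq: "a \<noteq> b" "a \<noteq> c" "a \<noteq> d" "a \<noteq> e" "b \<noteq> c" "b \<noteq> d" "b \<noteq> e" "c \<noteq> d" "c \<noteq> e" "d \<noteq> e"
    using pos by auto
  have s1: "subword (w \<circ> transpose a b)"
    by (rule subword_comp_transpose[OF subword_w]) (use pos val neq in simp_all)
  have s2: "subword (w \<circ> transpose a b \<circ> transpose a d)"
    by (rule subword_comp_transpose[OF s1]) (use pos val neq in simp_all)
  have s3: "subword (w \<circ> transpose a b \<circ> transpose a d \<circ> transpose b e)"
    by (rule subword_comp_transpose[OF s2]) (use pos val neq in simp_all)
  have s4: "subword (w \<circ> transpose a b \<circ> transpose a d \<circ> transpose b e \<circ> transpose c d)"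
    by (rule subword_comp_transpose[OF s3]) (use pos val neq in simp_all)
  have s5: "subword (w \<circ> transpose a b \<circ> transpose a d \<circ> transpose b e \<circ> transpose c d \<circ> transpose d e)"
    by (rule subword_comp_transpose[OF s4]) (use pos val neq in simp_all)
  \<comment> \<open>In cycle notation \<open>?p\<close> is (a d)(b e c), and
    \<open>w \<circ> ?p\<close> reads 13245. On b, c, e the values of \<open>w\<close> are 2, 5, 3,
    so b is in no inversion.\<close>
  let ?p = "transpose a b \<circ> transpose a d \<circ> transpose b e \<circ> transpose c d \<circ> transpose d e"
  have "subword (w \<circ> ?p)"
    using s5 by (simp only: comp_assoc)
  then show ?thesis
    by (rule subword_obstruction[where K = "{b, c, e}" and L = "{b}"])
      (use range pos val neq in auto)
qed

lemma pattern_351624_not_surjective: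
  assumes "pattern_at {1..n} w [3,5,1,6,2,4] xs"
  shows "\<phi> n ss w ` decreasing_chains n ss \<noteq> bruhat_interval n w"
proof -
  have "length xs = 6"
    using assms by (simp add: pattern_at_def)
  then obtain a b c d e f where xs: "xs = [a, b, c, d, e, f]"
    by (auto simp: numeral_eq_Suc length_Suc_conv)
  have range: "{a, b, c, d, e, f} \<subseteq> {1..n}"
    and pos: "a < b" "b < c" "c < d" "d < e" "e < f"
    and val: "w c < w e" "w e < w a" "w a < w f" "w f < w b" "w b < w d"
    using assms by (auto simp: xs pattern_at_def All_less_Suc numeral_eq_Suc)
  have neq: "a \<noteq> b" "a \<noteq> c" "a \<noteq> d" "a \<noteq> e" "a \<noteq> f" "b \<noteq> c" "b \<noteq> d" "b \<noteq> e" "b \<noteq> f" "c \<noteq> d" "c \<noteq> e" "c \<noteq> f" "d \<noteq> e" "d \<noteq> f" "e \<noteq> f"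
    using pos by auto
  have s1: "subword (w \<circ> transpose a c)"
    by (rule subword_comp_transpose[OF subword_w]) (use pos val neq in simp_all)
  have s2: "subword (w \<circ> transpose a c \<circ> transpose b c)"
    by (rule subword_comp_transpose[OF s1]) (use pos val neq in simp_all)
  have s3: "subword (w \<circ> transpose a c \<circ> transpose b c \<circ> transpose b e)"
    by (rule subword_comp_transpose[OF s2]) (use pos val neq in simp_all)
  have s4: "subword (w \<circ> transpose a c \<circ> transpose b c \<circ> transpose b e \<circ> transpose c f)"
    by (rule subword_comp_transpose[OF s3]) (use pos val neq in simp_all)
  have s5: "subword (w \<circ> transpose a c \<circ> transpose b c \<circ> transpose b e \<circ> transpose c f \<circ> transpose d e)"
    by (rule subword_comp_transpose[OF s4]) (use pos val neq in simp_all)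
  have s6: "subword (w \<circ> transpose a c \<circ> transpose b c \<circ> transpose b e \<circ> transpose c f \<circ> transpose d e \<circ> transpose e f)"
    by (rule subword_comp_transpose[OF s5]) (use pos val neq in simp_all)
  \<comment> \<open>In cycle notation \<open>?p\<close> is (a c f d)(b e), and
    \<open>w \<circ> ?p\<close> reads 124356. On a, c, d, f the values of \<open>w\<close> are 3, 1,
    6, 4, with inversions only inside the first and the last pair.\<close>
  let ?p = "transpose a c \<circ> transpose b c \<circ> transpose b e \<circ> transpose c f \<circ> transpose d e \<circ> transpose e f"
  have "subword (w \<circ> ?p)"
    using s6 by (simp only: comp_assoc)
  then show ?thesis
    by (rule subword_obstruction[where K = "{a, c, d, f}" and L = "{a, c}"])
      (use range pos val neq in auto)
qed

end

theorem theorem3p4: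
  fixes n :: nat and w :: "nat \<Rightarrow> nat" and ss :: "(nat \<Rightarrow> nat) list"
  assumes "w permutes {1..n}"
    and "reduced_expression n ss w"
  shows "\<phi> n ss w ` decreasing_chains n ss \<subseteq> bruhat_interval n w \<and>
    (\<phi> n ss w ` decreasing_chains n ss = bruhat_interval n w \<longleftrightarrow>
       avoids n w [4,2,3,1] \<and> avoids n w [3,5,1,4,2] \<and>
       avoids n w [4,2,5,1,3] \<and> avoids n w [3,5,1,6,2,4]) \<and>
    (\<phi> n ss w ` decreasing_chains n ss = bruhat_interval n w \<longrightarrow>
       bij_betw (\<phi> n ss w) (decreasing_chains n ss) (bruhat_interval n w))"
    (is "?sub \<and> (?surj \<longleftrightarrow> ?avoids) \<and> (?surj \<longrightarrow> ?bij)")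
proof (intro conjI)
  interpret reduced_word n w ss
    using assms by (rule reduced_word.intro)
  show ?sub
    by (rule phi_image_subset)
  show "?surj \<longleftrightarrow> ?avoids"
  proof
    assume ?surj
    then show ?avoids
      using pattern_4231_not_surjective pattern_35142_not_surjective
        pattern_42513_not_surjective pattern_351624_not_surjective
      unfolding avoids_iff_no_pattern_at by blast
  next
    assume ?avoids
    then have "avoiding_permutation n w"
      using assms(1) by unfold_locales auto
    then show ?surj
      using avoiding_imp_surjective phi_image_subset by blast
  qed
  show "?surj \<longrightarrow> ?bij"
    using phi_inj by (simp add: bij_betw_def)
qed

end
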